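(* If a Martin-Löf random real $z\in[0,1]$ is not a density-one point, then $z$ is uniformly almost everywhere dominating; that is, $z$ computes a function $f\colon\mathbb{N}\to\mathbb{N}$ such that for almost every oracle $A\in2^\omega$ (with respect to Lebesgue measure), $f$ dominates every $A$-computable function.
   Context: Reals are identified with binary expansions. Martin-Löf randomness: not in $\bigcap_nU_n$ for any uniformly c.e. sequence of open classes with $\lambda(U_n)\le2^{-n}$. An effectively closed class $\mathcal{C}\subseteq[0,1]$ has complement equal to the union of an effective sequence of rational open intervals. $\varrho(\mathcal{C}\mid z)=\liminf_{\gamma,\delta\to0^+}\frac{\lambda([z-\gamma,z+\delta]\cap\mathcal{C})}{\gamma+\delta}$; $z$ is a density-one point if $\varrho(\mathcal{C}\mid z)=1$ for every effectively closed $\mathcal{C}\ni z$. $f$ dominates $h$ if $f(n)\ge h(n)$ for all but finitely many $n$. *)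

theory Defs
  imports "HOL-Probability.Probability" "HOL-Library.Nat_Bijection"
begin

section \<open>Computability relative to an oracle\<close>

text \<open>
  Partial recursive functions of arbitrary arity relative to an oracle (Kleene's schemata plus one
  schema for querying the oracle). \<^emph>\<open>Orc\<close> queries the characteristic function of the oracle.
  \<^emph>\<open>Mu\<close> is unbounded minimisation: all smaller arguments must converge to a nonzero value.
\<close>

datatype prog =
    Zero
  | Succ
  | Proj nat
  | Orc
  | Comp prog "prog list"
  | Prec prog prog
  | Mu prog

text \<open>\<^emph>\<open>computes A p xs y\<close>: program \<^emph>\<open>p\<close> with oracle \<^emph>\<open>A\<close> halts on input \<^emph>\<open>xs\<close> with output \<^emph>\<open>y\<close>.\<close>

inductive computes :: "(nat \<Rightarrow> bool) \<Rightarrow> prog \<Rightarrow> nat list \<Rightarrow> nat \<Rightarrow> bool"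
  for A :: "nat \<Rightarrow> bool" where
  Zero: "computes A Zero xs 0"
| Succ: "computes A Succ (x # xs) (Suc x)"
| Proj: "i < length xs \<Longrightarrow> computes A (Proj i) xs (xs ! i)"
| Orc: "computes A Orc (x # xs) (of_bool (A x))"
| Comp: "list_all2 (\<lambda>g y. computes A g xs y) gs ys \<Longrightarrow> computes A f ys z
    \<Longrightarrow> computes A (Comp f gs) xs z"
| Prec_0: "computes A f xs y \<Longrightarrow> computes A (Prec f g) (0 # xs) y"
| Prec_Suc: "computes A (Prec f g) (n # xs) r \<Longrightarrow> computes A g (n # r # xs) y
    \<Longrightarrow> computes A (Prec f g) (Suc n # xs) y"
| Mu: "computes A f (n # xs) 0 \<Longrightarrow> (\<And>m. m < n \<Longrightarrow> \<exists>y. computes A f (m # xs) (Suc y))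
    \<Longrightarrow> computes A (Mu f) xs n"

inductive_cases computes_elims:
  "computes A Zero xs y"
  "computes A Succ xs y"
  "computes A (Proj i) xs y"
  "computes A Orc xs y"
  "computes A (Comp f gs) xs y"
  "computes A (Prec f g) (0 # xs) y"
  "computes A (Prec f g) (Suc n # xs) y"
  "computes A (Mu f) xs y"

lemma computes_deterministic:
  "computes A p xs y \<Longrightarrow> computes A p xs y' \<Longrightarrow> y = y'"
proof (induction arbitrary: y' rule: computes.induct)
  case (Zero xs)
  then show ?case by (rule computes_elims) simp
next
  case (Succ x xs)
  then show ?case by (rule computes_elims) simp
next
  case (Proj i xs)
  from Proj.prems show ?case by (rule computes_elims) simp
next
  case (Orc x xs)
  then show ?case by (rule computes_elims) simp
next
  case (Comp xs gs ys f z)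
  from Comp.prems obtain ys' where 1: "list_all2 (\<lambda>g y. computes A g xs y) gs ys'"
    and 2: "computes A f ys' y'"
    by (rule computes_elims)
  have "ys = ys'"
    using Comp.IH(1) 1 by (simp add: list_all2_conv_all_nth list_eq_iff_nth_eq)
  with 2 Comp.IH(2) show ?case by blast
next
  case (Prec_0 f xs y g)
  from Prec_0.prems show ?case by (rule computes_elims) (rule Prec_0.IH)
next
  case (Prec_Suc f g n xs r y)
  from Prec_Suc.prems obtain r' where 1: "computes A (Prec f g) (n # xs) r'"
    and 2: "computes A g (n # r' # xs) y'"
    by (rule computes_elims)
  have "r = r'" using 1 by (rule Prec_Suc.IH)
  with 2 Prec_Suc.IH(2) show ?case by blast
next
  case (Mu f n xs)
  from Mu.prems have 1: "computes A f (y' # xs) 0"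
    and 2: "\<And>m. m < y' \<Longrightarrow> \<exists>y. computes A f (m # xs) (Suc y)"
    by (auto elim: computes_elims(8))
  show ?case
  proof (rule linorder_cases[of n y'])
    assume "n < y'"
    with 2 obtain y where "computes A f (n # xs) (Suc y)" by blast
    with Mu.IH(1) have "0 = Suc y" by blast
    then show ?thesis by simp
  next
    assume "y' < n"
    with Mu.IH(2) obtain y where "\<And>w. computes A f (y' # xs) w \<Longrightarrow> Suc y = w" by blast
    with 1 have "Suc y = 0" by blast
    then show ?thesis by simp
  qed
qed

definition computable_in :: "(nat \<Rightarrow> bool) \<Rightarrow> (nat \<Rightarrow> nat) \<Rightarrow> bool" where
  "computable_in A h \<longleftrightarrow> (\<exists>p. \<forall>n. computes A p [n] (h n))"

abbreviation empty_oracle :: "nat \<Rightarrow> bool" where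
  "empty_oracle \<equiv> (\<lambda>_. False)"

definition computable :: "(nat \<Rightarrow> nat) \<Rightarrow> bool" where
  "computable h \<longleftrightarrow> computable_in empty_oracle h"

text \<open>
  A real is identified with its binary expansion. A dyadic rational in the open unit interval has
  two expansions; both are computable, so the existential quantifier below is harmless.
\<close>

definition binary_expansion :: "(nat \<Rightarrow> bool) \<Rightarrow> real \<Rightarrow> bool" where
  "binary_expansion A z \<longleftrightarrow> (\<lambda>n. of_bool (A n) * (1 / 2) ^ Suc n) sums z"

definition real_computes :: "real \<Rightarrow> (nat \<Rightarrow> nat) \<Rightarrow> bool" where
  "real_computes z f \<longleftrightarrow> (\<exists>A. binary_expansion A z \<and> computable_in A f)"


section \<open>Effectively open and closed classes of reals\<close>

text \<open>An effective enumeration (with repetitions) of the rationals.\<close>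

definition rat_code :: "nat \<Rightarrow> real" where
  "rat_code n = (case prod_decode n of (p, q) \<Rightarrow> real_of_int (int_decode p) / real (Suc q))"

text \<open>
  Classes are subsets of the unit interval and open means relatively open. An interval
  whose endpoints are in the wrong order is empty.
\<close>

definition rat_interval :: "nat \<Rightarrow> nat \<Rightarrow> real set" where
  "rat_interval i j = {rat_code i <..< rat_code j}"

definition effectively_closed :: "real set \<Rightarrow> bool" where
  "effectively_closed C \<longleftrightarrow> C \<subseteq> {0..1} \<and>
     (\<exists>a b. computable a \<and> computable b \<and>
        {0..1} - C = {0..1} \<inter> (\<Union>k. rat_interval (a k) (b k)))"

text \<open>
  \<^emph>\<open>U n\<close> is the union of the rational intervals enumerated into the \<^emph>\<open>n\<close>-th c.e. set; c.e. sets are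
  the domains of partial computable functions, here uniformly in \<^emph>\<open>n\<close>.
\<close>

definition uniformly_ce_open :: "(nat \<Rightarrow> real set) \<Rightarrow> bool" where
  "uniformly_ce_open U \<longleftrightarrow>
     (\<exists>e. \<forall>n. U n = {0..1} \<inter> \<Union> {rat_interval i j | i j. \<exists>y. computes empty_oracle e [n, i, j] y})"

definition martin_loef_random :: "real \<Rightarrow> bool" where
  "martin_loef_random z \<longleftrightarrow>
     \<not> (\<exists>U. uniformly_ce_open U \<and> (\<forall>n. measure lborel (U n) \<le> 1 / 2 ^ n) \<and> z \<in> (\<Inter>n. U n))"


section \<open>Density\<close>

definition lower_density :: "real set \<Rightarrow> real \<Rightarrow> ereal" where
  "lower_density C z =
     Liminf (at_right 0 \<times>\<^sub>F at_right 0)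
       (\<lambda>(\<gamma>, \<delta>). ereal (measure lborel ({z - \<gamma> .. z + \<delta>} \<inter> C) / (\<gamma> + \<delta>)))"

definition density_one_point :: "real \<Rightarrow> bool" where
  "density_one_point z \<longleftrightarrow> (\<forall>C. effectively_closed C \<and> z \<in> C \<longrightarrow> lower_density C z = 1)"


section \<open>Uniform almost everywhere domination\<close>

definition dominates :: "(nat \<Rightarrow> nat) \<Rightarrow> (nat \<Rightarrow> nat) \<Rightarrow> bool" where
  "dominates f h \<longleftrightarrow> (\<forall>\<^sub>F n in sequentially. h n \<le> f n)"

definition cantor_measure :: "(nat \<Rightarrow> bool) measure" where
  "cantor_measure = (\<Pi>\<^sub>M n\<in>UNIV. measure_pmf (bernoulli_pmf (1 / 2)))"

definition uniformly_ae_dominating :: "real \<Rightarrow> bool" where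
  "uniformly_ae_dominating z \<longleftrightarrow>
     (\<exists>f. real_computes z f \<and>
        (AE A in cantor_measure. \<forall>h. computable_in A h \<longrightarrow> dominates f h))"

end

theory Submission
  imports Defs
begin

text \<open>
  Near a point \<open>z\<close> of \<open>C\<close> with lower density below 1, arbitrarily small intervals around \<open>z\<close> lose a
  fixed fraction of their length to the complement of \<open>C\<close>, and \<open>z\<close> can compute a stage at which
  such a loss has become visible. Let \<open>f (n + 1)\<close> be such a stage, found inside the dyadic cell of
  \<open>z\<close> of level \<open>f n\<close>. If \<open>h\<close> is computable from \<open>A\<close> and not dominated by \<open>f\<close>, then along some
  sequence of stages computable from \<open>A\<close> infinitely many losses around \<open>z\<close> are witnessed. A
  supermartingale, based on the weak-type inequality, shows that the points that survive \<open>n\<close> such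
  losses have measure at most \<open>q\<^sup>n\<close> for some \<open>q < 1\<close>. As \<open>z\<close> would thus fail a test relative to
  \<open>A\<close>, averaging over \<open>A\<close> yields an ordinary Martin-Loef test, which \<open>z\<close> passes; hence the
  bad oracles form a null set.
\<close>

subsection \<open>Total recursive functions\<close>

text \<open>One number \<open>s\<close> serves as time and as resolution: stage \<open>s\<close>
  sees the first \<open>s\<close> intervals of the complement and \<open>s\<close> oracle bits, and
  speaks about cells of level \<open>s\<close>. A drop between \<open>t\<close> and \<open>s\<close>
  is counted only inside the level-\<open>t\<close> cell of the point. This localisation shapes the
  proof. If that cell is alive at \<open>t\<close>, its subcells that are dead at \<open>s\<close>
  have not been charged to any earlier drop, so the weak-type inequality can be applied afresh in
  each cell and the losses multiply. Drops also persist when \<open>[t, s]\<close> is widened, so an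
  increment of an oracle's stages that contains two consecutive values of \<open>f\<close> inherits
  the drop at \<open>z\<close>. The averaging has to remove the oracle from the test. At level
  \<open>s\<close> it collects the cells that are caught for more than the fraction
  \<open>1 / N\<close> of the \<open>2 ^ s\<close> oracle prefixes. This is decidable without an
  oracle, and by double counting these cells have measure at most \<open>N * q ^ n\<close>. Escaping
  one such component means that at most the fraction \<open>1 / N\<close> of the oracles catches
  \<open>z\<close> with the corresponding number of drops; \<open>N\<close> is arbitrary.\<close>

definition recfun :: "(nat \<Rightarrow> bool) \<Rightarrow> nat \<Rightarrow> (nat list \<Rightarrow> nat) \<Rightarrow> bool" where
  "recfun A k F \<longleftrightarrow> (\<exists>p. \<forall>xs. length xs = k \<longrightarrow> computes A p xs (F xs))"

lemma recfun_cong: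
  assumes "recfun A k F" "\<And>xs. length xs = k \<Longrightarrow> G xs = F xs"
  shows "recfun A k G"
  using assms unfolding recfun_def by metis

lemma recfun_nth: "i < k \<Longrightarrow> recfun A k (\<lambda>xs. xs ! i)"
  unfolding recfun_def by (metis computes.Proj)

lemma recfun_comp_list:
  assumes H: "recfun A n H" and G: "\<forall>g\<in>set Gs. recfun A k g" and n: "length Gs = n"
  shows "recfun A k (\<lambda>xs. H (map (\<lambda>g. g xs) Gs))"
proof -
  obtain p where p: "\<And>xs. length xs = n \<Longrightarrow> computes A p xs (H xs)"
    using H by (auto simp: recfun_def)
  obtain e where e: "\<And>g xs. g \<in> set Gs \<Longrightarrow> length xs = k \<Longrightarrow> computes A (e g) xs (g xs)"
    using G unfolding recfun_def by metis
  have "computes A (Comp p (map e Gs)) xs (H (map (\<lambda>g. g xs) Gs))" if "length xs = k" for xs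
    by (rule computes.Comp[where ys = "map (\<lambda>g. g xs) Gs"])
       (auto simp: list_all2_conv_all_nth that e n intro!: p)
  then show ?thesis unfolding recfun_def by blast
qed

text \<open>Higher-order unification applies the closure rules below to concrete terms: arguments
  are \<open>xs ! i\<close>, and a binder prepends its variable, so that outer arguments become \<open>tl xs ! i\<close>.\<close>
lemma recfun_comp1:
  assumes "recfun A 1 (\<lambda>xs. h (xs ! 0))" "recfun A k F"
  shows "recfun A k (\<lambda>xs. h (F xs))"
  using recfun_comp_list[OF assms(1), of "[F]" k] assms(2) by simp

lemma recfun_comp2:
  assumes "recfun A 2 (\<lambda>xs. h (xs ! 0) (xs ! 1))" "recfun A k F" "recfun A k G"
  shows "recfun A k (\<lambda>xs. h (F xs) (G xs))"
  using recfun_comp_list[OF assms(1), of "[F, G]" k] assms(2,3) by simp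

lemma recfun_comp3:
  assumes "recfun A 3 (\<lambda>xs. h (xs ! 0) (xs ! 1) (xs ! 2))" "recfun A k F" "recfun A k G" "recfun A k H"
  shows "recfun A k (\<lambda>xs. h (F xs) (G xs) (H xs))"
  using recfun_comp_list[OF assms(1), of "[F, G, H]" k] assms(2-4) by simp

lemma recfun_comp4:
  assumes "recfun A 4 (\<lambda>xs. h (xs ! 0) (xs ! 1) (xs ! 2) (xs ! 3))"
    "recfun A k F" "recfun A k G" "recfun A k H" "recfun A k I"
  shows "recfun A k (\<lambda>xs. h (F xs) (G xs) (H xs) (I xs))"
  using recfun_comp_list[OF assms(1), of "[F, G, H, I]" k] assms(2-5) by simp

lemma recfun_0: "recfun A k (\<lambda>xs. 0)"
  unfolding recfun_def by (metis computes.Zero)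

lemma recfun_Suc:
  assumes "recfun A k F"
  shows "recfun A k (\<lambda>xs. Suc (F xs))"
proof (rule recfun_comp1[OF _ assms])
  have "computes A Succ xs (Suc (xs ! 0))" if "length xs = 1" for xs
    using that by (auto simp: length_Suc_conv intro: computes.Succ)
  then show "recfun A 1 (\<lambda>xs. Suc (xs ! 0))" unfolding recfun_def by blast
qed

lemma recfun_const: "recfun A k (\<lambda>xs. c)"
  by (induction c) (auto intro: recfun_0 recfun_Suc)

lemma recfun_oracle:
  assumes "recfun A k F"
  shows "recfun A k (\<lambda>xs. of_bool (A (F xs)))"
proof (rule recfun_comp1[OF _ assms])
  have "computes A Orc xs (of_bool (A (xs ! 0)))" if "length xs = 1" for xs
    using that computes.Orc[of A "xs ! 0" "[]"] by (auto simp: length_Suc_conv)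
  then show "recfun A 1 (\<lambda>xs. of_bool (A (xs ! 0)))" unfolding recfun_def by blast
qed

lemma recfun_rec_nat:
  assumes F: "recfun A k F" and G: "recfun A (Suc (Suc k)) (\<lambda>ys. G (ys ! 0) (ys ! 1) (tl (tl ys)))"
    and N: "recfun A k N"
  shows "recfun A k (\<lambda>xs. rec_nat (F xs) (\<lambda>n r. G n r xs) (N xs))"
proof -
  obtain pf where pf: "\<And>xs. length xs = k \<Longrightarrow> computes A pf xs (F xs)"
    using F by (auto simp: recfun_def)
  obtain pg where pg: "\<And>ys. length ys = Suc (Suc k) \<Longrightarrow> computes A pg ys (G (ys ! 0) (ys ! 1) (tl (tl ys)))"
    using G by (auto simp: recfun_def)
  let ?H = "\<lambda>ys. rec_nat (F (tl ys)) (\<lambda>n r. G n r (tl ys)) (ys ! 0)"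
  have "computes A (Prec pf pg) (n # xs) (?H (n # xs))" if "length xs = k" for n xs
  proof (induction n)
    case 0
    show ?case using that by (auto intro: computes.Prec_0 pf)
  next
    case (Suc n)
    show ?case
      using computes.Prec_Suc[OF Suc pg] that by simp
  qed
  then have "computes A (Prec pf pg) ys (?H ys)" if "length ys = Suc k" for ys
    using that by (cases ys) auto
  then have H: "recfun A (Suc k) ?H" unfolding recfun_def by blast
  \<comment> \<open>\<open>Prec\<close> wants the recursion argument in front; \<open>N\<close> is
    substituted there and the projections restore the parameter list behind it.\<close>
  have "recfun A k (\<lambda>xs. ?H (map (\<lambda>g. g xs) (N # map (\<lambda>i xs. xs ! i) [0..<k])))"
    by (rule recfun_comp_list[OF H]) (auto intro: N recfun_nth)
  moreover have "map ((!) xs) [0..<k] = xs" if "length xs = k" for xs :: "nat list"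
    using map_nth[of xs] that by simp
  ultimately show ?thesis
    by (elim recfun_cong) (simp add: comp_def)
qed

lemma recfun_tl1: "Suc i < k \<Longrightarrow> recfun A k (\<lambda>xs. tl xs ! i)"
  by (rule recfun_cong[OF recfun_nth[of "Suc i"]]) (auto simp: nth_tl)

lemma recfun_tl2: "Suc (Suc i) < k \<Longrightarrow> recfun A k (\<lambda>xs. tl (tl xs) ! i)"
  by (rule recfun_cong[OF recfun_nth[of "Suc (Suc i)"]]) (auto simp: nth_tl)

lemma recfun_tl3: "Suc (Suc (Suc i)) < k \<Longrightarrow> recfun A k (\<lambda>xs. tl (tl (tl xs)) ! i)"
  by (rule recfun_cong[OF recfun_nth[of "Suc (Suc (Suc i))"]]) (auto simp: nth_tl)

lemma recfun_add:
  assumes "recfun A k F" "recfun A k G"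
  shows "recfun A k (\<lambda>xs. F xs + G xs)"
proof (rule recfun_comp2[OF _ assms])
  have "recfun A 2 (\<lambda>xs. rec_nat (xs ! 0) (\<lambda>n r. Suc r) (xs ! 1))"
    by (intro recfun_rec_nat recfun_Suc recfun_nth) auto
  moreover have "m + n = rec_nat m (\<lambda>n r. Suc r) n" for m n :: nat by (induction n) auto
  ultimately show "recfun A 2 (\<lambda>xs. xs ! 0 + xs ! 1)" by simp
qed

lemma recfun_mult:
  assumes "recfun A k F" "recfun A k G"
  shows "recfun A k (\<lambda>xs. F xs * G xs)"
proof (rule recfun_comp2[OF _ assms])
  have "recfun A 2 (\<lambda>xs. rec_nat 0 (\<lambda>n r. r + xs ! 0) (xs ! 1))"
    by (intro recfun_rec_nat recfun_add recfun_nth recfun_const recfun_tl2) auto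
  moreover have "m * n = rec_nat 0 (\<lambda>n r. r + m) n" for m n :: nat by (induction n) auto
  ultimately show "recfun A 2 (\<lambda>xs. xs ! 0 * xs ! 1)" by simp
qed

lemma recfun_diff:
  assumes "recfun A k F" "recfun A k G"
  shows "recfun A k (\<lambda>xs. F xs - G xs)"
proof (rule recfun_comp2[OF _ assms])
  have pred: "recfun A k (\<lambda>xs. F xs - 1)" if "recfun A k F" for k F
  proof (rule recfun_comp1[OF _ that])
    have "recfun A 1 (\<lambda>xs. rec_nat 0 (\<lambda>n r. n) (xs ! 0))"
      by (intro recfun_rec_nat recfun_nth recfun_const) auto
    moreover have "rec_nat 0 (\<lambda>n r. n) m = m - 1" for m :: nat by (cases m) auto
    ultimately show "recfun A 1 (\<lambda>xs. xs ! 0 - 1)" by simp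
  qed
  have "recfun A 2 (\<lambda>xs. rec_nat (xs ! 0) (\<lambda>n r. r - 1) (xs ! 1))"
    by (intro recfun_rec_nat pred recfun_nth) auto
  moreover have "rec_nat m (\<lambda>n r. r - 1) n = m - n" for m n :: nat by (induction n) auto
  ultimately show "recfun A 2 (\<lambda>xs. xs ! 0 - xs ! 1)" by simp
qed

lemma recfun_less:
  assumes "recfun A k F" "recfun A k G"
  shows "recfun A k (\<lambda>xs. of_bool (F xs < G xs))"
proof -
  have "recfun A k (\<lambda>xs. 1 - (1 - (G xs - F xs)))"
    by (intro recfun_diff recfun_const assms)
  then show ?thesis by (rule recfun_cong) auto
qed

lemma recfun_not:
  assumes "recfun A k (\<lambda>xs. of_bool (P xs))"
  shows "recfun A k (\<lambda>xs. of_bool (\<not> P xs))"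
proof -
  have "recfun A k (\<lambda>xs. 1 - of_bool (P xs))"
    by (intro recfun_diff recfun_const assms)
  then show ?thesis by (rule recfun_cong) auto
qed

lemma recfun_conj:
  assumes "recfun A k (\<lambda>xs. of_bool (P xs))" "recfun A k (\<lambda>xs. of_bool (Q xs))"
  shows "recfun A k (\<lambda>xs. of_bool (P xs \<and> Q xs))"
  by (rule recfun_cong[OF recfun_mult[OF assms]]) auto

lemma recfun_disj:
  assumes "recfun A k (\<lambda>xs. of_bool (P xs))" "recfun A k (\<lambda>xs. of_bool (Q xs))"
  shows "recfun A k (\<lambda>xs. of_bool (P xs \<or> Q xs))"
  by (rule recfun_cong[OF recfun_not[OF recfun_conj[OF recfun_not[OF assms(1)] recfun_not[OF assms(2)]]]]) auto

lemma recfun_le: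
  assumes "recfun A k F" "recfun A k G"
  shows "recfun A k (\<lambda>xs. of_bool (F xs \<le> G xs))"
  by (rule recfun_cong[OF recfun_not[OF recfun_less[OF assms(2,1)]]]) auto

lemma recfun_eq:
  assumes "recfun A k F" "recfun A k G"
  shows "recfun A k (\<lambda>xs. of_bool (F xs = G xs))"
  by (rule recfun_cong[OF recfun_conj[OF recfun_le[OF assms] recfun_le[OF assms(2,1)]]]) auto

lemma recfun_if:
  assumes "recfun A k (\<lambda>xs. of_bool (P xs))" "recfun A k F" "recfun A k G"
  shows "recfun A k (\<lambda>xs. if P xs then F xs else G xs)"
proof -
  have "recfun A k (\<lambda>xs. of_bool (P xs) * F xs + (1 - of_bool (P xs)) * G xs)"
    by (intro recfun_add recfun_mult recfun_diff recfun_const assms)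
  then show ?thesis by (rule recfun_cong) auto
qed

text \<open>Inserts a dummy second argument: a recursion step receives the accumulator, which a
  summand ignores.\<close>

lemma recfun_weaken2:
  assumes "recfun A (Suc k) (\<lambda>ys. G (ys ! 0) (tl ys))"
  shows "recfun A (Suc (Suc k)) (\<lambda>ys. G (ys ! 0) (tl (tl ys)))"
proof -
  let ?Gs = "map (\<lambda>i xs. xs ! i) (0 # [2..<Suc (Suc k)])"
  have "recfun A (Suc (Suc k)) (\<lambda>xs. (\<lambda>ys. G (ys ! 0) (tl ys)) (map (\<lambda>g. g xs) ?Gs))"
    by (rule recfun_comp_list[OF assms]) (auto intro: recfun_nth)
  moreover have "map ((!) xs) [2..<Suc (Suc k)] = tl (tl xs)" if "length xs = Suc (Suc k)" for xs :: "nat list"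
    by (rule nth_equalityI) (auto simp: nth_tl that simp del: upt_Suc)
  ultimately show ?thesis
    by (elim recfun_cong) (simp add: comp_def del: upt_Suc)
qed

lemma recfun_sum:
  assumes "recfun A (Suc k) (\<lambda>ys. G (ys ! 0) (tl ys))" "recfun A k N"
  shows "recfun A k (\<lambda>xs. \<Sum>i<N xs. G i xs)"
proof -
  have "recfun A k (\<lambda>xs. rec_nat 0 (\<lambda>i r. r + G i xs) (N xs))"
    by (intro recfun_rec_nat recfun_add recfun_nth recfun_const assms recfun_weaken2) auto
  moreover have "(\<Sum>i<n. g i) = rec_nat 0 (\<lambda>i r. r + g i) n" for n and g :: "nat \<Rightarrow> nat"
    by (induction n) auto
  ultimately show ?thesis by simp
qed

lemma recfun_card:
  assumes "recfun A (Suc k) (\<lambda>ys. of_bool (P (ys ! 0) (tl ys)))" "recfun A k N"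
  shows "recfun A k (\<lambda>xs. card {i. i < N xs \<and> P i xs})"
proof -
  have "(\<Sum>i<n. of_bool (Q i)) = card {i. i < n \<and> Q i}" for n :: nat and Q
    by (simp add: sum.If_cases of_bool_def lessThan_def Collect_conj_eq)
  then show ?thesis using recfun_sum[of A k "\<lambda>i xs. of_bool (P i xs)" N, OF assms] by simp
qed

lemma recfun_ex:
  assumes "recfun A (Suc k) (\<lambda>ys. of_bool (P (ys ! 0) (tl ys)))" "recfun A k N"
  shows "recfun A k (\<lambda>xs. of_bool (\<exists>i<N xs. P i xs))"
  by (rule recfun_cong[OF recfun_less[OF recfun_0 recfun_card[OF assms]]]) (auto simp: card_gt_0_iff)

lemma recfun_all:
  assumes "recfun A (Suc k) (\<lambda>ys. of_bool (P (ys ! 0) (tl ys)))" "recfun A k N"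
  shows "recfun A k (\<lambda>xs. of_bool (\<forall>i<N xs. P i xs))"
  by (rule recfun_cong[OF recfun_not[OF recfun_ex[where P = "\<lambda>i xs. \<not> P i xs", OF recfun_not[OF assms(1)] assms(2)]]]) auto

lemma recfun_power2:
  assumes "recfun A k F"
  shows "recfun A k (\<lambda>xs. 2 ^ F xs)"
proof (rule recfun_comp1[OF _ assms])
  have "recfun A 1 (\<lambda>xs. rec_nat 1 (\<lambda>n r. 2 * r) (xs ! 0))"
    by (intro recfun_rec_nat recfun_mult recfun_nth recfun_const) auto
  moreover have "rec_nat 1 (\<lambda>n r. 2 * r) n = (2 ^ n :: nat)" for n by (induction n) auto
  ultimately show "recfun A 1 (\<lambda>xs. 2 ^ (xs ! 0))" by simp
qed

lemma recfun_div:
  assumes "recfun A k F" "recfun A k G"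
  shows "recfun A k (\<lambda>xs. F xs div G xs)"
proof (rule recfun_comp2[OF _ assms])
  \<comment> \<open>The quotient is the number of positive multiples of the divisor up to the
    dividend; the guard produces the value 0 for division by 0.\<close>
  have "recfun A 2 (\<lambda>xs. card {i. i < xs ! 0 \<and> (0 < xs ! 1 \<and> Suc i * (xs ! 1) \<le> xs ! 0)})"
    by (intro recfun_card recfun_conj recfun_less recfun_le recfun_mult recfun_Suc recfun_nth recfun_const recfun_tl1) auto
  moreover have "m div d = card {i. i < m \<and> (0 < d \<and> Suc i * d \<le> m)}" for m d :: nat
  proof (cases "d = 0")
    case False
    then have "i < m div d \<longleftrightarrow> Suc i * d \<le> m" for i
      using less_eq_div_iff_mult_less_eq[of d "Suc i" m] by (simp add: Suc_le_eq del: mult_Suc)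
    moreover have "i < m div d \<Longrightarrow> i < m" for i
      using div_le_dividend[of m d] by linarith
    ultimately have "{i. i < m \<and> (0 < d \<and> Suc i * d \<le> m)} = {..< m div d}"
      using False by (auto simp del: mult_Suc)
    then show ?thesis by simp
  qed auto
  ultimately show "recfun A 2 (\<lambda>xs. xs ! 0 div xs ! 1)" by simp
qed

lemma recfun_mod:
  assumes "recfun A k F" "recfun A k G"
  shows "recfun A k (\<lambda>xs. F xs mod G xs)"
  unfolding minus_mult_div_eq_mod[symmetric]
  by (intro recfun_diff recfun_mult recfun_div assms)

lemmas recfun_intros = recfun_nth recfun_tl1 recfun_tl2 recfun_tl3 recfun_const recfun_Suc recfun_add recfun_mult
  recfun_diff recfun_less recfun_le recfun_eq recfun_not recfun_conj recfun_disj recfun_if recfun_sum recfun_card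
  recfun_ex recfun_all recfun_power2 recfun_div recfun_mod

lemma recfun_prod_encode:
  assumes "recfun A k F" "recfun A k G"
  shows "recfun A k (\<lambda>xs. prod_encode (F xs, G xs))"
  unfolding prod_encode_def triangle_def
  by (simp, intro recfun_intros assms)

section \<open>Transfer of programs from the empty oracle to any oracle\<close>

fun oracle_free :: "prog \<Rightarrow> prog" where
  "oracle_free Orc = Zero"
| "oracle_free (Comp f gs) = Comp (oracle_free f) (map oracle_free gs)"
| "oracle_free (Prec f g) = Prec (oracle_free f) (oracle_free g)"
| "oracle_free (Mu f) = Mu (oracle_free f)"
| "oracle_free p = p"

text \<open>The empty oracle answers every query with 0, as \<open>Zero\<close> does. The
  implication goes one way only, since \<open>Zero\<close> also halts on the empty argument list. It
  makes the computable interval sequences of the closed class available to programs with oracle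
  \<open>z\<close>.\<close>

lemma computes_oracle_free:
  "computes empty_oracle p xs y \<Longrightarrow> computes A (oracle_free p) xs y"
proof (induction rule: computes.induct)
  case (Orc x xs)
  then show ?case using computes.Zero by simp
next
  case (Comp xs gs ys f z)
  then show ?case
    by (auto simp: list_all2_conv_all_nth intro!: computes.Comp[where ys = ys])
next
  case (Prec_Suc f g n xs r y)
  then show ?case by (auto intro: computes.Prec_Suc)
next
  case (Mu f n xs)
  then show ?case by (auto intro!: computes.Mu)
qed (auto intro: computes.intros)

lemma computable_imp_recfun:
  assumes "computable h" "recfun A k F"
  shows "recfun A k (\<lambda>xs. h (F xs))"
proof (rule recfun_comp1[OF _ assms(2)])
  obtain p where p: "\<And>n. computes empty_oracle p [n] (h n)"
    using assms(1) by (auto simp: computable_def computable_in_def)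
  have "computes A (oracle_free p) xs (h (xs ! 0))" if "length xs = 1" for xs
    using that computes_oracle_free[OF p, of A "xs ! 0"] by (auto simp: length_Suc_conv)
  then show "recfun A 1 (\<lambda>xs. h (xs ! 0))" unfolding recfun_def by blast
qed

subsection \<open>Bounded evaluation of oracle programs\<close>

text \<open>The result \<open>0\<close> means undefined and \<open>Suc y\<close> means value \<open>y\<close>. The first \<open>s\<close> bits of the oracle
  are the binary digits of \<open>\<sigma>\<close>, least significant first; \<open>s\<close> bounds both the oracle queries and the
  minimisations, so no further fuel is needed.\<close>
fun beval :: "prog \<Rightarrow> nat \<Rightarrow> nat \<Rightarrow> nat list \<Rightarrow> nat" where
  "beval Zero \<sigma> s xs = 1"
| "beval Succ \<sigma> s xs = (case xs of [] \<Rightarrow> 0 | x # _ \<Rightarrow> Suc (Suc x))"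
| "beval (Proj i) \<sigma> s xs = (if i < length xs then Suc (xs ! i) else 0)"
| "beval Orc \<sigma> s xs = (case xs of [] \<Rightarrow> 0 | x # _ \<Rightarrow> if x < s then Suc ((\<sigma> div 2 ^ x) mod 2) else 0)"
| "beval (Comp f gs) \<sigma> s xs =
     (if \<forall>g\<in>set gs. beval g \<sigma> s xs \<noteq> 0 then beval f \<sigma> s (map (\<lambda>g. beval g \<sigma> s xs - 1) gs) else 0)"
| "beval (Prec f g) \<sigma> s xs =
     (case xs of [] \<Rightarrow> 0
      | n # zs \<Rightarrow> rec_nat (beval f \<sigma> s zs) (\<lambda>i r. if r = 0 then 0 else beval g \<sigma> s (i # (r - 1) # zs)) n)"
| "beval (Mu f) \<sigma> s xs =
     (\<Sum>i<s. of_bool (beval f \<sigma> s (i # xs) = 1 \<and> (\<forall>m<i. 2 \<le> beval f \<sigma> s (m # xs))) * Suc i)"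

text \<open>At most one index satisfies the condition of a minimisation, so the sum that stands for
  the bounded search has at most one nonzero summand.\<close>

lemma beval_Mu_eq_Suc:
  "beval (Mu f) \<sigma> s xs = Suc n \<longleftrightarrow>
     n < s \<and> beval f \<sigma> s (n # xs) = 1 \<and> (\<forall>m<n. 2 \<le> beval f \<sigma> s (m # xs))"
proof -
  let ?P = "\<lambda>i. beval f \<sigma> s (i # xs) = 1 \<and> (\<forall>m<i. 2 \<le> beval f \<sigma> s (m # xs))"
  have uniq: "i = n" if "?P i" "?P n" for i n
    using that by (cases i n rule: linorder_cases) auto
  have sum: "(\<Sum>i<s. of_bool (?P i) * Suc i) = Suc n" if "n < s" "?P n" for n
  proof -
    have "?P i = (i = n)" for i using uniq[of i n] that by blast
    then have "(\<Sum>i<s. of_bool (?P i) * Suc i) = (\<Sum>i<s. of_bool (i = n) * Suc i)"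
      by (simp only:)
    also have "\<dots> = (\<Sum>i<s. if i = n then Suc n else 0)" by (intro sum.cong) auto
    also have "\<dots> = Suc n" using that by (simp add: sum.delta)
    finally show ?thesis .
  qed
  show ?thesis
  proof
    assume *: "beval (Mu f) \<sigma> s xs = Suc n"
    have "\<exists>i<s. ?P i"
    proof (rule ccontr)
      assume "\<not> (\<exists>i<s. ?P i)"
      then have "(\<Sum>i<s. of_bool (?P i) * Suc i) = 0" by (intro sum.neutral) auto
      with * show False by (simp only: beval.simps)
    qed
    then obtain i where i: "i < s" "?P i" by blast
    from sum[OF i] * have "i = n" by (simp only: beval.simps nat.inject)
    with i show "n < s \<and> ?P n" by blast
  next
    assume "n < s \<and> ?P n"
    with sum[of n] show "beval (Mu f) \<sigma> s xs = Suc n" unfolding beval.simps by blast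
  qed
qed

text \<open>The use principle: a successful evaluation has consulted only bits below
  \<open>s\<close> and only minimisation values below \<open>s\<close>, so it is unaffected by
  further bits and a larger bound.\<close>

lemma beval_mono:
  assumes "s \<le> s'" "\<And>x. x < s \<Longrightarrow> (\<sigma>' div 2 ^ x) mod 2 = (\<sigma> div 2 ^ x) mod (2::nat)"
  shows "beval p \<sigma> s xs = Suc y \<Longrightarrow> beval p \<sigma>' s' xs = Suc y"
proof (induction p arbitrary: xs y)
  case (Comp f gs)
  have nz: "\<forall>g\<in>set gs. beval g \<sigma> s xs \<noteq> 0"
    and f: "beval f \<sigma> s (map (\<lambda>g. beval g \<sigma> s xs - 1) gs) = Suc y"
    using Comp.prems by (auto split: if_splits)
  have eq: "beval g \<sigma>' s' xs = beval g \<sigma> s xs" if "g \<in> set gs" for g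
    using Comp.IH(2)[OF that, of xs "beval g \<sigma> s xs - 1"] nz that by auto
  then have "map (\<lambda>g. beval g \<sigma>' s' xs - 1) gs = map (\<lambda>g. beval g \<sigma> s xs - 1) gs"
    by (auto cong: map_cong)
  with Comp.IH(1)[OF f] nz eq show ?case by (simp only: beval.simps) simp
next
  case (Prec f g)
  obtain n zs where xs: "xs = n # zs" using Prec.prems by (cases xs) auto
  let ?R = "\<lambda>\<sigma> s. rec_nat (beval f \<sigma> s zs) (\<lambda>i r. if r = 0 then 0 else beval g \<sigma> s (i # (r - 1) # zs))"
  have "?R \<sigma> s n = Suc y \<Longrightarrow> ?R \<sigma>' s' n = Suc y" for y
  proof (induction n arbitrary: y)
    case 0
    then show ?case using Prec.IH(1) by simp
  next
    case (Suc n)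
    then obtain r where r: "?R \<sigma> s n = Suc r" by (cases "?R \<sigma> s n") auto
    then show ?case using Suc.prems Suc.IH[OF r] Prec.IH(2) by simp
  qed
  then show ?case using Prec.prems by (simp add: xs)
next
  case (Mu f)
  then have *: "y < s" "beval f \<sigma> s (y # xs) = 1" "\<forall>m<y. 2 \<le> beval f \<sigma> s (m # xs)"
    unfolding beval_Mu_eq_Suc by auto
  have "2 \<le> beval f \<sigma>' s' (m # xs)" if "m < y" for m
    using *(3) Mu.IH[of "m # xs" "beval f \<sigma> s (m # xs) - 1"] that by force
  then show ?case unfolding beval_Mu_eq_Suc using * Mu.IH[of "y # xs" 0] assms(1) by auto
qed (use assms in \<open>auto split: list.splits if_splits\<close>)

section \<open>Oracle prefixes as numbers\<close>

definition prefix_code :: "(nat \<Rightarrow> bool) \<Rightarrow> nat \<Rightarrow> nat" where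
  "prefix_code A s = (\<Sum>i<s. of_bool (A i) * 2 ^ i)"

lemma prefix_code_Suc: "prefix_code A (Suc s) = prefix_code A s + of_bool (A s) * 2 ^ s"
  by (simp add: prefix_code_def)

lemma prefix_code_less: "prefix_code A s < 2 ^ s"
  by (induction s) (auto simp: prefix_code_Suc prefix_code_def[of A 0])

lemma prefix_code_bit:
  "x < s \<Longrightarrow> (prefix_code A s div 2 ^ x) mod 2 = of_bool (A x)"
proof (induction s)
  case (Suc s)
  show ?case
  proof (cases "x = s")
    case True
    then show ?thesis using prefix_code_less[of A s] by (simp add: prefix_code_Suc)
  next
    case False
    then have "x < s" using Suc.prems by simp
    then obtain d where d: "s = x + Suc d" using less_imp_Suc_add[OF \<open>x < s\<close>] by auto
    have "prefix_code A (Suc s) = prefix_code A s + (of_bool (A s) * 2 ^ Suc d) * 2 ^ x"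
      unfolding prefix_code_Suc by (simp add: d power_add)
    then have "prefix_code A (Suc s) div 2 ^ x = of_bool (A s) * 2 ^ Suc d + prefix_code A s div 2 ^ x"
      by (simp only: div_mult_self1 power_not_zero zero_neq_numeral[symmetric] not_False_eq_True)
    then show ?thesis using Suc.IH[OF \<open>x < s\<close>] by simp
  qed
qed simp

lemma prefix_code_bit_mono:
  "x < s \<Longrightarrow> s \<le> s' \<Longrightarrow> (prefix_code A s' div 2 ^ x) mod 2 = (prefix_code A s div 2 ^ x) mod 2"
  by (simp add: prefix_code_bit)

lemma beval_prefix_code_mono:
  "beval p (prefix_code A s) s xs = Suc y \<Longrightarrow> s \<le> s' \<Longrightarrow> beval p (prefix_code A s') s' xs = Suc y"
  by (rule beval_mono[of s s']) (auto intro: prefix_code_bit_mono)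

text \<open>Each rule has finitely many premises that matter, and each of them succeeds from some
  bound on; by the use principle the maximum of these bounds serves all of them.\<close>

lemma computes_imp_beval:
  "computes A p xs y \<Longrightarrow> \<exists>s. \<forall>s'\<ge>s. beval p (prefix_code A s') s' xs = Suc y"
proof -
  assume "computes A p xs y"
  then have "\<exists>s. beval p (prefix_code A s) s xs = Suc y"
  proof (induction rule: computes.induct)
    case (Orc x xs)
    have "beval Orc (prefix_code A (Suc x)) (Suc x) (x # xs) = Suc (of_bool (A x))"
      by (simp add: prefix_code_bit)
    then show ?case by blast
  next
    case (Comp xs gs ys f z)
    from Comp.IH(1) obtain s1 where
      s1: "\<And>i. i < length gs \<Longrightarrow> beval (gs ! i) (prefix_code A (s1 i)) (s1 i) xs = Suc (ys ! i)"
      and len: "length gs = length ys"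
      unfolding list_all2_conv_all_nth by metis
    from Comp.IH(2) obtain s2 where s2: "beval f (prefix_code A s2) s2 ys = Suc z" by blast
    define s where "s = Max (insert s2 (s1 ` {..<length gs}))"
    have s: "s2 \<le> s" "\<And>i. i < length gs \<Longrightarrow> s1 i \<le> s" unfolding s_def by auto
    have e: "beval (gs ! i) (prefix_code A s) s xs = Suc (ys ! i)" if "i < length gs" for i
      by (rule beval_prefix_code_mono[OF s1 s(2)]) (use that in auto)
    then have "map (\<lambda>g. beval g (prefix_code A s) s xs - 1) gs = ys"
      using len by (auto intro: nth_equalityI)
    moreover have "\<forall>g\<in>set gs. beval g (prefix_code A s) s xs \<noteq> 0"
      using e by (auto simp: in_set_conv_nth)
    ultimately have "beval (Comp f gs) (prefix_code A s) s xs = Suc z"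
      using beval_prefix_code_mono[OF s2 s(1)] by simp
    then show ?case by blast
  next
    case (Prec_0 f xs y g)
    then show ?case by simp
  next
    case (Prec_Suc f g n xs r y)
    then obtain s1 s2 where s: "beval (Prec f g) (prefix_code A s1) s1 (n # xs) = Suc r"
      "beval g (prefix_code A s2) s2 (n # r # xs) = Suc y" by blast
    show ?case
      using beval_prefix_code_mono[OF s(1), of "max s1 s2"] beval_prefix_code_mono[OF s(2), of "max s1 s2"]
      by (intro exI[of _ "max s1 s2"]) simp
  next
    case (Mu f n xs)
    from Mu.IH(2) have "\<forall>m. \<exists>y s. m < n \<longrightarrow> beval f (prefix_code A s) s (m # xs) = Suc (Suc y)"
      by blast
    then obtain y s1 where s1: "\<And>m. m < n \<Longrightarrow> beval f (prefix_code A (s1 m)) (s1 m) (m # xs) = Suc (Suc (y m))"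
      by metis
    from Mu.IH(1) obtain s2 where s2: "beval f (prefix_code A s2) s2 (n # xs) = Suc 0" by blast
    define s where "s = Max (insert (Suc n) (insert s2 (s1 ` {..<n})))"
    have s: "n < s" "s2 \<le> s" "\<And>i. i < n \<Longrightarrow> s1 i \<le> s"
      unfolding s_def Suc_le_eq[symmetric] by (auto intro!: Max_ge simp del: Max_insert)
    have "beval f (prefix_code A s) s (m # xs) = Suc (Suc (y m))" if "m < n" for m
      by (rule beval_prefix_code_mono[OF s1 s(3)]) (use that in auto)
    then have "beval (Mu f) (prefix_code A s) s xs = Suc n"
      unfolding beval_Mu_eq_Suc using s(1) beval_prefix_code_mono[OF s2 s(2)] by auto
    then show ?case by blast
  qed auto
  then show ?thesis using beval_prefix_code_mono by blast
qed

section \<open>Bounded evaluation of a fixed program is primitive recursive\<close>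

lemma recfun_beval_args:
  assumes "recfun B (Suc (Suc (length Gs))) (\<lambda>ys. beval p (ys ! 0) (ys ! 1) (tl (tl ys)))"
    and "recfun B k S" "recfun B k T" "\<forall>g\<in>set Gs. recfun B k g"
  shows "recfun B k (\<lambda>xs. beval p (S xs) (T xs) (map (\<lambda>g. g xs) Gs))"
  using recfun_comp_list[OF assms(1), of "S # T # Gs" k] assms(2-4) by simp

lemma recfun_ball_list:
  assumes "\<And>g. g \<in> set gs \<Longrightarrow> recfun B k (\<lambda>xs. of_bool (P g xs))"
  shows "recfun B k (\<lambda>xs. of_bool (\<forall>g\<in>set gs. P g xs))"
  using assms
proof (induction gs)
  case Nil
  show ?case using recfun_const[of B k 1] by simp
next
  case (Cons g gs)
  have "recfun B k (\<lambda>xs. of_bool (P g xs \<and> (\<forall>g\<in>set gs. P g xs)))"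
    by (intro recfun_conj Cons) (use Cons.prems in auto)
  then show ?case by simp
qed

lemma drop_eq_tl:
  "tl xs = drop 1 xs" "tl (drop n xs) = drop (Suc n) xs"
  by (auto simp: drop_Suc tl_drop)

lemma map_nth_upt_drop: "length xs = m \<Longrightarrow> map ((!) xs) [j..<m] = drop j xs"
  by (auto intro: nth_equalityI)

text \<open>The program is fixed and the induction runs over its structure, which suffices because
  every test below concerns a single program. The arity \<open>k\<close> stays general, as
  composition, recursion and minimisation evaluate their parts on lists of other lengths.\<close>

lemma recfun_beval: "recfun B (Suc (Suc k)) (\<lambda>ys. beval p (ys ! 0) (ys ! 1) (tl (tl ys)))"
proof (induction p arbitrary: k)
  case Zero
  show ?case by (simp add: recfun_const)
next
  case Succ
  show ?case
  proof (cases k)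
    case 0
    show ?thesis by (rule recfun_cong[OF recfun_0]) (auto simp: 0 length_Suc_conv)
  next
    case (Suc l)
    have "recfun B (Suc (Suc k)) (\<lambda>ys. Suc (Suc (tl (tl ys) ! 0)))"
      by (intro recfun_intros) (simp add: Suc)
    then show ?thesis by (rule recfun_cong) (auto simp: Suc length_Suc_conv)
  qed
next
  case (Proj i)
  have "recfun B (Suc (Suc k)) (\<lambda>ys. if i < k then Suc (tl (tl ys) ! i) else 0)"
    by (cases "i < k") (auto intro!: recfun_intros)
  then show ?case by (rule recfun_cong) auto
next
  case Orc
  show ?case
  proof (cases k)
    case 0
    show ?thesis by (rule recfun_cong[OF recfun_0]) (auto simp: 0 length_Suc_conv)
  next
    case (Suc l)
    have "recfun B (Suc (Suc k)) (\<lambda>ys. if tl (tl ys) ! 0 < ys ! 1 then Suc ((ys ! 0 div 2 ^ (tl (tl ys) ! 0)) mod 2) else 0)"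
      by (intro recfun_intros) (simp_all add: Suc)
    then show ?thesis by (rule recfun_cong) (auto simp: Suc length_Suc_conv)
  qed
next
  case (Comp f gs)
  let ?Gs = "map (\<lambda>g ys. beval g (ys ! 0) (ys ! 1) (tl (tl ys)) - 1) gs"
  have "recfun B (Suc (Suc k)) (\<lambda>ys. if \<forall>g\<in>set gs. \<not> beval g (ys ! 0) (ys ! 1) (tl (tl ys)) = 0
      then beval f (ys ! 0) (ys ! 1) (map (\<lambda>g. g ys) ?Gs) else 0)"
    by (intro recfun_if recfun_ball_list recfun_not recfun_eq recfun_const recfun_beval_args)
       (auto simp del: One_nat_def intro!: Comp.IH recfun_intros)
  then show ?case by (rule recfun_cong) (auto simp: comp_def)
next
  case (Prec f g)
  show ?case
  proof (cases k)
    case 0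
    show ?thesis by (rule recfun_cong[OF recfun_0]) (auto simp: 0 length_Suc_conv)
  next
    case (Suc l)
    let ?F = "\<lambda>ys. beval f (ys ! 0) (ys ! 1) (drop 3 ys)"
    let ?G = "\<lambda>i r ys. if r = 0 then 0 else beval g (ys ! 0) (ys ! 1) (i # (r - 1) # drop 3 ys)"
    let ?Gs = "map (\<lambda>i ys. ys ! i) [3..<3 + l]"
    let ?Hs = "(\<lambda>ys. ys ! 0) # (\<lambda>ys. ys ! 1 - 1) # map (\<lambda>i ys. ys ! i) [5..<5 + l]"
    have "recfun B (3 + l) (\<lambda>ys. beval f (ys ! 0) (ys ! 1) (map (\<lambda>g. g ys) ?Gs))"
      by (intro recfun_beval_args Prec.IH) (auto intro!: recfun_intros)
    then have F: "recfun B (3 + l) ?F"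
      by (rule recfun_cong) (simp add: comp_def map_nth_upt_drop del: upt_Suc)
    have arity: "Suc (Suc (3 + l)) = 5 + l" by simp
    have "recfun B (5 + l) (\<lambda>ys. if ys ! 1 = 0 then 0 else beval g (ys ! 2) (ys ! 3) (map (\<lambda>g. g ys) ?Hs))"
      by (intro recfun_if recfun_eq recfun_const recfun_beval_args Prec.IH) (auto intro!: recfun_intros)
    then have G: "recfun B (Suc (Suc (3 + l))) (\<lambda>ys. ?G (ys ! 0) (ys ! 1) (tl (tl ys)))"
      unfolding arity by (rule recfun_cong)
         (auto simp add: comp_def map_nth_upt_drop drop_eq_tl nth_tl eval_nat_numeral simp del: upt_Suc)
    have N: "recfun B (3 + l) (\<lambda>ys. ys ! 2)" by (intro recfun_intros) simp
    have arity': "Suc (Suc k) = 3 + l" by (simp add: Suc)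
    from recfun_rec_nat[OF F G N] show ?thesis
      unfolding arity' by (rule recfun_cong)
         (auto simp: Suc length_Suc_conv eval_nat_numeral cong: if_cong)
  qed
next
  case (Mu f)
  let ?Gs = "(\<lambda>ys. ys ! 0) # map (\<lambda>i ys. ys ! i) [3..<3 + k]"
  let ?Hs = "(\<lambda>ys. ys ! 0) # map (\<lambda>i ys. ys ! i) [4..<4 + k]"
  have arity: "Suc (Suc (Suc k)) = 3 + k" "Suc (Suc (Suc (Suc k))) = 4 + k" by simp_all
  have "recfun B (3 + k) (\<lambda>ys. beval f (ys ! 1) (ys ! 2) (map (\<lambda>g. g ys) ?Gs))"
    by (intro recfun_beval_args Mu.IH) (auto intro!: recfun_intros)
  then have 1: "recfun B (Suc (Suc (Suc k))) (\<lambda>ys. beval f (tl ys ! 0) (tl ys ! 1) (ys ! 0 # tl (tl (tl ys))))"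
    unfolding arity(1) by (rule recfun_cong)
       (auto simp add: comp_def map_nth_upt_drop drop_eq_tl nth_tl eval_nat_numeral simp del: upt_Suc)
  have "recfun B (4 + k) (\<lambda>ys. beval f (ys ! 2) (ys ! 3) (map (\<lambda>g. g ys) ?Hs))"
    by (intro recfun_beval_args Mu.IH) (auto intro!: recfun_intros)
  then have 2: "recfun B (Suc (Suc (Suc (Suc k))))
      (\<lambda>ys. beval f (tl (tl ys) ! 0) (tl (tl ys) ! 1) (ys ! 0 # tl (tl (tl (tl ys)))))"
    unfolding arity(2) by (rule recfun_cong)
       (auto simp add: comp_def map_nth_upt_drop drop_eq_tl nth_tl eval_nat_numeral simp del: upt_Suc)
  show ?case unfolding beval.simps
    by (intro recfun_sum recfun_mult recfun_conj recfun_eq recfun_all recfun_le 1 2 recfun_intros) auto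
qed

lemma recfun_beval_unary:
  assumes "recfun B k S" "recfun B k T" "recfun B k N"
  shows "recfun B k (\<lambda>xs. beval p (S xs) (T xs) [N xs])"
  using recfun_beval_args[of B "[N]" p k S T] recfun_beval assms by simp

subsection \<open>Martin-Loef tests built from dyadic cells\<close>

text \<open>The first clause computes a function by unbounded search, the second identifies the
  domain of the search program, which is how a decidable matrix yields a c.e. set.\<close>

lemma recfun_search:
  assumes "recfun A (Suc k) (\<lambda>ys. of_bool (P (ys ! 0) (tl ys)))"
  obtains e where
    "\<And>xs w. length xs = k \<Longrightarrow> P w xs \<Longrightarrow> computes A e xs (LEAST w. P w xs)"
    "\<And>xs y. length xs = k \<Longrightarrow> computes A e xs y \<Longrightarrow> \<exists>w. P w xs"
proof -
  obtain p where p: "\<And>ys. length ys = Suc k \<Longrightarrow> computes A p ys (of_bool (\<not> P (ys ! 0) (tl ys)))"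
    using recfun_not[OF assms] unfolding recfun_def by blast
  have p': "computes A p (w # xs) (of_bool (\<not> P w xs))" if "length xs = k" for w xs
    using p[of "w # xs"] that by simp
  show thesis
  proof (rule that[of "Mu p"])
    fix xs w assume len: "length xs = k" and "P w xs"
    then have "P (LEAST w. P w xs) xs" by (metis LeastI)
    show "computes A (Mu p) xs (LEAST w. P w xs)"
    proof (rule computes.Mu)
      show "computes A p ((LEAST w. P w xs) # xs) 0"
        using p'[OF len, of "LEAST w. P w xs"] \<open>P (LEAST w. P w xs) xs\<close> by simp
      fix m assume "m < (LEAST w. P w xs)"
      then have "\<not> P m xs" by (rule not_less_Least)
      then show "\<exists>y. computes A p (m # xs) (Suc y)" using p'[OF len, of m] by auto
    qed
  next
    fix xs y assume len: "length xs = k" and "computes A (Mu p) xs y"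
    then have "computes A p (y # xs) 0" by (auto elim: computes_elims(8))
    from computes_deterministic[OF this p'[OF len]] show "\<exists>w. P w xs" by (auto split: if_splits)
  qed
qed

text \<open>Two cells wide and centred at a grid point, so that one family of open intervals both
  surrounds dyadic points and, for odd \<open>c\<close> and positive \<open>s\<close>, gives the
  interiors of the cells of level \<open>s - 1\<close>.\<close>

definition dyadic_ball :: "nat \<Rightarrow> nat \<Rightarrow> real set" where
  "dyadic_ball s c = {(real c - 1) / 2 ^ s <..< (real c + 1) / 2 ^ s}"

text \<open>Under \<open>int_decode\<close> the even code \<open>2 * m\<close> stands for
  \<open>m\<close> and the code \<open>1\<close> for \<open>-1\<close>, the left numerator when
  \<open>c = 0\<close>. A denominator is coded by its predecessor.\<close>

lemma rat_interval_dyadic_ball: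
  "rat_interval (prod_encode (if c = 0 then 1 else 2 * (c - 1), 2 ^ s - 1)) (prod_encode (2 * (c + 1), 2 ^ s - 1))
    = dyadic_ball s c"
  by (cases c) (auto simp: rat_interval_def dyadic_ball_def rat_code_def int_decode_def sum_decode_def)

lemma uniformly_ce_open_dyadic_balls:
  assumes "recfun empty_oracle 3 (\<lambda>xs. of_bool (R (xs ! 0) (xs ! 1) (xs ! 2)))"
  shows "uniformly_ce_open (\<lambda>m. {0..1} \<inter> \<Union> {dyadic_ball s c | s c. R m s c})"
proof -
  define lo where "lo s c = prod_encode (if c = 0 then 1 else 2 * (c - 1), 2 ^ s - 1)" for s c :: nat
  define hi where "hi s c = prod_encode (2 * (c + 1), 2 ^ s - 1)" for s c :: nat
  \<comment> \<open>Minimisation ranges over a single number, so \<open>w\<close> bounds both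
    \<open>s\<close> and \<open>c\<close>.\<close>
  define P where "P w xs \<longleftrightarrow> (\<exists>s<Suc w. \<exists>c<Suc w. R (xs ! 0) s c \<and> xs ! 1 = lo s c \<and> xs ! 2 = hi s c)"
    for w :: nat and xs :: "nat list"
  have "recfun empty_oracle (Suc 3) (\<lambda>ys. of_bool (P (ys ! 0) (tl ys)))"
    unfolding P_def lo_def hi_def
    by (intro recfun_ex recfun_conj recfun_comp3[OF assms] recfun_eq recfun_prod_encode recfun_intros) auto
  then obtain e where e: "\<And>xs w. length xs = 3 \<Longrightarrow> P w xs \<Longrightarrow> computes empty_oracle e xs (LEAST w. P w xs)"
    "\<And>xs y. length xs = 3 \<Longrightarrow> computes empty_oracle e xs y \<Longrightarrow> \<exists>w. P w xs"
    by (rule recfun_search) blast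
  have iff: "(\<exists>y. computes empty_oracle e [m, i, j] y) \<longleftrightarrow> (\<exists>s c. R m s c \<and> i = lo s c \<and> j = hi s c)" for m i j
  proof
    assume "\<exists>y. computes empty_oracle e [m, i, j] y"
    then have "\<exists>w. P w [m, i, j]" using e(2)[of "[m, i, j]"] by auto
    then show "\<exists>s c. R m s c \<and> i = lo s c \<and> j = hi s c" by (auto simp: P_def)
  next
    assume "\<exists>s c. R m s c \<and> i = lo s c \<and> j = hi s c"
    then obtain s c where "R m s c" "i = lo s c" "j = hi s c" by blast
    then have "P (max s c) [m, i, j]"
      unfolding P_def by (intro exI[of _ s] exI[of _ c] conjI) auto
    then show "\<exists>y. computes empty_oracle e [m, i, j] y" using e(1)[of "[m, i, j]"] by auto
  qed
  have ball: "rat_interval (lo s c) (hi s c) = dyadic_ball s c" for s c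
    unfolding lo_def hi_def by (rule rat_interval_dyadic_ball)
  have "{rat_interval i j | i j. \<exists>s c. R m s c \<and> i = lo s c \<and> j = hi s c} = {dyadic_ball s c | s c. R m s c}" for m
    using ball by fastforce
  then show ?thesis
    unfolding uniformly_ce_open_def by (intro exI[of _ e]) (simp only: iff simp_thms)
qed

lemma martin_loef_random_dyadic_balls:
  assumes "martin_loef_random z" "z \<in> {0..1}"
    and "recfun empty_oracle 3 (\<lambda>xs. of_bool (R (xs ! 0) (xs ! 1) (xs ! 2)))"
    and "\<And>m. emeasure lborel ({0..1} \<inter> \<Union> {dyadic_ball s c | s c. R m s c}) \<le> ennreal (1 / 2 ^ m)"
  shows "\<exists>m. \<forall>s c. R m s c \<longrightarrow> z \<notin> dyadic_ball s c"
proof (rule ccontr)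
  assume "\<not> ?thesis"
  then have "z \<in> (\<Inter>m. {0..1} \<inter> \<Union> {dyadic_ball s c | s c. R m s c})" using assms(2) by fast
  moreover have "measure lborel ({0..1} \<inter> \<Union> {dyadic_ball s c | s c. R m s c}) \<le> 1 / 2 ^ m" for m
    unfolding measure_def by (rule enn2real_leI[OF _ assms(4)]) simp
  ultimately show False
    using assms(1) uniformly_ce_open_dyadic_balls[OF assms(3)] unfolding martin_loef_random_def by blast
qed

text \<open>A dyadic point is captured by an explicit test. Its absence keeps \<open>z\<close> away
  from the right end 1 and in the interior of each of its cells.\<close>

lemma martin_loef_random_not_dyadic:
  assumes "martin_loef_random z" "z \<in> {0..1}"
  shows "z \<noteq> real x / 2 ^ n"
proof
  assume z: "z = real x / 2 ^ n"
  \<comment> \<open>The ball is centred at \<open>x / 2 ^ n\<close>, rewritten with denominator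
    \<open>2 ^ (m + n + 1)\<close>, and its length \<open>2 / 2 ^ (m + n + 1)\<close> is at most
    \<open>1 / 2 ^ m\<close>.\<close>
  define R where "R m s c \<longleftrightarrow> s = m + n + 1 \<and> c = x * 2 ^ (m + 1)" for m s c :: nat
  have "\<exists>m. \<forall>s c. R m s c \<longrightarrow> z \<notin> dyadic_ball s c"
  proof (rule martin_loef_random_dyadic_balls[OF assms])
    show "recfun empty_oracle 3 (\<lambda>xs. of_bool (R (xs ! 0) (xs ! 1) (xs ! 2)))"
      unfolding R_def by (intro recfun_conj recfun_eq recfun_add recfun_intros) auto
    fix m
    have "emeasure lborel ({0..1} \<inter> \<Union> {dyadic_ball s c | s c. R m s c})
      \<le> emeasure lborel (dyadic_ball (m + n + 1) (x * 2 ^ (m + 1)))"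
      by (intro emeasure_mono) (auto simp: R_def dyadic_ball_def)
    also have "\<dots> = ennreal (2 / 2 ^ (m + n + 1))"
      by (simp add: dyadic_ball_def divide_right_mono diff_divide_distrib[symmetric])
    also have "\<dots> \<le> ennreal (1 / 2 ^ m)"
      by (intro ennreal_leI) (simp add: power_add field_simps)
    finally show "emeasure lborel ({0..1} \<inter> \<Union> {dyadic_ball s c | s c. R m s c}) \<le> ennreal (1 / 2 ^ m)" .
  qed
  moreover have "z \<in> dyadic_ball (m + n + 1) (x * 2 ^ (m + 1))" for m
    by (simp add: z dyadic_ball_def power_add field_simps)
  ultimately show False unfolding R_def by blast
qed

section \<open>Dyadic cells of a real number\<close>

definition cell :: "real \<Rightarrow> nat \<Rightarrow> nat" where
  "cell x s = nat \<lfloor>x * 2 ^ s\<rfloor>"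

lemma cell_div:
  assumes "0 \<le> x" "s \<le> s'"
  shows "cell x s' div 2 ^ (s' - s) = cell x s"
proof -
  have "x * 2 ^ s = x * 2 ^ s' / real_of_int (2 ^ (s' - s))"
    using assms(2) by (simp add: field_simps flip: power_add)
  then have "\<lfloor>x * 2 ^ s\<rfloor> = \<lfloor>x * 2 ^ s'\<rfloor> div 2 ^ (s' - s)"
    by (simp only: floor_divide_real_eq_div zero_le_power zero_le_numeral)
  then show ?thesis
    using assms(1) by (simp add: cell_def nat_div_distrib nat_power_eq)
qed

lemma cell_bounds:
  assumes "0 \<le> x"
  shows "real (cell x s) \<le> x * 2 ^ s" "x * 2 ^ s < real (cell x s) + 1"
  using assms by (auto simp: cell_def)

lemma cell_eqI:
  assumes "real c \<le> x * 2 ^ s" "x * 2 ^ s < real c + 1"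
  shows "cell x s = c"
proof -
  have "\<lfloor>x * 2 ^ s\<rfloor> = int c" using assms by (simp add: floor_eq_iff)
  then show ?thesis by (simp add: cell_def)
qed

lemma cell_less:
  assumes "0 \<le> x" "x < 1"
  shows "cell x s < 2 ^ s"
proof -
  have "real (cell x s) < 2 ^ s" using cell_bounds(1)[OF assms(1), of s] assms(2)
    by (smt (verit) mult_less_cancel_right2 zero_less_power)
  then show ?thesis by (metis of_nat_less_iff of_nat_numeral of_nat_power)
qed

text \<open>Closure under subdivision makes the unions of selected half-open cells increase with
  \<open>s\<close>, so a bound on the count at every single level bounds the measure of the whole
  class. Passing to open cells loses only dyadic points, and \<open>z\<close> is none.\<close>

lemma martin_loef_random_cells:
  assumes "martin_loef_random z" "z \<in> {0..1}"
    and R: "recfun empty_oracle 3 (\<lambda>xs. of_bool (R (xs ! 0) (xs ! 1) (xs ! 2)))"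
    and mono: "\<And>m s c. R m s (c div 2) \<Longrightarrow> R m (Suc s) c"
    and card: "\<And>m s. real (card {c. c < 2 ^ s \<and> R m s c}) \<le> 2 ^ s / 2 ^ m"
  shows "\<exists>m. \<forall>s. \<not> R m s (cell z s)"
proof -
  \<comment> \<open>The cell \<open>c div 2\<close> of level \<open>s - 1\<close> is represented by
    the ball around its midpoint, which is the odd grid point \<open>c\<close> of level
    \<open>s\<close>.\<close>
  define R' where "R' m s c \<longleftrightarrow> 0 < s \<and> c mod 2 = 1 \<and> c div 2 < 2 ^ (s - 1) \<and> R m (s - 1) (c div 2)" for m s c
  have ball: "dyadic_ball (Suc s) (Suc (2 * c)) = {real c / 2 ^ s <..< (real c + 1) / 2 ^ s}" for s c
    by (auto simp: dyadic_ball_def field_simps)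
  have z: "0 \<le> z" "z < 1"
    using assms(2) martin_loef_random_not_dyadic[OF assms(1,2), of 1 0] by auto
  have "\<exists>m. \<forall>s c. R' m s c \<longrightarrow> z \<notin> dyadic_ball s c"
  proof (rule martin_loef_random_dyadic_balls[OF assms(1,2)])
    show "recfun empty_oracle 3 (\<lambda>xs. of_bool (R' (xs ! 0) (xs ! 1) (xs ! 2)))"
      unfolding R'_def by (intro recfun_conj recfun_comp3[OF R] recfun_intros) auto
    fix m
    define V where "V s = (\<Union>c\<in>{c. c < 2 ^ s \<and> R m s c}. {real c / 2 ^ s ..< (real c + 1) / 2 ^ s})" for s
    have V_iff: "x \<in> V s \<longleftrightarrow> 0 \<le> x \<and> x < 1 \<and> R m s (cell x s)" for x s
    proof
      assume "x \<in> V s"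
      then obtain c where c: "c < 2 ^ s" "R m s c" "real c / 2 ^ s \<le> x" "x < (real c + 1) / 2 ^ s"
        by (auto simp: V_def)
      have "real (c + 1) \<le> 2 ^ s" using c(1) by (metis Suc_eq_plus1 Suc_leI of_nat_le_iff of_nat_numeral of_nat_power)
      then have "(real c + 1) / 2 ^ s \<le> 1" by simp
      moreover have "0 \<le> real c / 2 ^ s" by simp
      moreover have "cell x s = c" by (rule cell_eqI) (use c in \<open>auto simp: field_simps\<close>)
      ultimately show "0 \<le> x \<and> x < 1 \<and> R m s (cell x s)" using c by (intro conjI; (linarith | simp))
    next
      assume x: "0 \<le> x \<and> x < 1 \<and> R m s (cell x s)"
      with cell_bounds[of x s] cell_less[of x s] show "x \<in> V s"
        by (auto simp: V_def field_simps intro!: exI[of _ "cell x s"])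
    qed
    have "incseq V"
    proof (rule incseq_SucI, rule subsetI)
      fix s x assume x: "x \<in> V s"
      then have "cell x (Suc s) div 2 = cell x s" using cell_div[of x s "Suc s"] V_iff by simp
      with x show "x \<in> V (Suc s)" using mono[of m s "cell x (Suc s)"] by (auto simp: V_iff)
    qed
    have "emeasure lborel (V s) \<le> ennreal (1 / 2 ^ m)" for s
    proof -
      let ?I = "{c. c < 2 ^ s \<and> R m s c}"
      have "emeasure lborel (V s) \<le> (\<Sum>c\<in>?I. emeasure lborel {real c / 2 ^ s ..< (real c + 1) / 2 ^ s})"
        unfolding V_def by (intro emeasure_subadditive_finite) auto
      also have "\<dots> = (\<Sum>c\<in>?I. ennreal (1 / 2 ^ s))"
        by (intro sum.cong refl) (simp add: divide_right_mono diff_divide_distrib[symmetric])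
      also have "\<dots> = ennreal (card ?I * (1 / 2 ^ s))"
        by (simp add: ennreal_of_nat_eq_real_of_nat ennreal_mult'[symmetric])
      also have "\<dots> \<le> ennreal (1 / 2 ^ m)"
        using card[of s m] by (intro ennreal_leI) (simp add: field_simps)
      finally show ?thesis .
    qed
    then have "(SUP s. emeasure lborel (V s)) \<le> ennreal (1 / 2 ^ m)"
      by (rule SUP_least)
    moreover have "(SUP s. emeasure lborel (V s)) = emeasure lborel (\<Union>s. V s)"
      by (intro SUP_emeasure_incseq \<open>incseq V\<close>) (auto simp: V_def)
    ultimately have "emeasure lborel (\<Union>s. V s) \<le> ennreal (1 / 2 ^ m)" by simp
    moreover have "emeasure lborel ({0..1} \<inter> \<Union> {dyadic_ball s c | s c. R' m s c}) \<le> emeasure lborel (\<Union>s. V s)"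
    proof (rule emeasure_mono)
      show "{0..1} \<inter> \<Union> {dyadic_ball s c | s c. R' m s c} \<subseteq> (\<Union>s. V s)"
      proof
        fix x assume "x \<in> {0..1} \<inter> \<Union> {dyadic_ball s c | s c. R' m s c}"
        then obtain s c where sc: "R' m s c" "x \<in> dyadic_ball s c" by auto
        then obtain t d where td: "s = Suc t" "c = Suc (2 * d)"
          unfolding R'_def by (metis Suc_pred' add.commute mult_div_mod_eq plus_1_eq_Suc)
        with sc have "d < 2 ^ t" "R m t d" "x \<in> {real d / 2 ^ t <..< (real d + 1) / 2 ^ t}"
          by (auto simp: R'_def ball)
        then have "x \<in> V t" by (auto simp: V_def intro!: exI[of _ d])
        then show "x \<in> (\<Union>s. V s)" by blast
      qed
    qed (auto simp: V_def)
    ultimately show "emeasure lborel ({0..1} \<inter> \<Union> {dyadic_ball s c | s c. R' m s c}) \<le> ennreal (1 / 2 ^ m)"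
      by (rule order_trans[rotated])
  qed
  then obtain m where m: "\<And>s c. R' m s c \<Longrightarrow> z \<notin> dyadic_ball s c" by blast
  have "\<not> R m s (cell z s)" for s
  proof
    assume "R m s (cell z s)"
    then have "R' m (Suc s) (Suc (2 * cell z s))"
      using cell_less[OF z] by (simp add: R'_def)
    moreover have "z \<in> dyadic_ball (Suc s) (Suc (2 * cell z s))"
    proof -
      have "z \<noteq> real (cell z s) / 2 ^ s" by (rule martin_loef_random_not_dyadic[OF assms(1,2)])
      then show ?thesis unfolding ball using cell_bounds[OF z(1), of s] by (auto simp: field_simps)
    qed
    ultimately show False using m by blast
  qed
  then show ?thesis by blast
qed

subsection \<open>Surviving many drops\<close>

text \<open>The one-sided maximal inequality holds with no loss in the constant, by a greedy scan
  from the left. If \<open>lo\<close> starts an interval \<open>{lo..<j}\<close> in which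
  \<open>S\<close> has density at least \<open>1 / M\<close>, the points of \<open>S\<close> in it
  pay for the whole interval and the scan resumes at \<open>j\<close>; otherwise \<open>lo\<close>
  is skipped. Intervals starting at \<open>j\<close> or later do not meet what has been paid
  for.\<close>

lemma card_right_maximal:
  fixes lo hi M :: nat
  shows "card {c\<in>{lo..<hi}. \<exists>j. c < j \<and> j \<le> hi \<and> j \<le> c + M * card (S \<inter> {c..<j})}
    \<le> M * card (S \<inter> {lo..<hi})"
proof (induction "hi - lo" arbitrary: lo rule: less_induct)
  case less
  let ?R = "\<lambda>lo. {c\<in>{lo..<hi}. \<exists>j. c < j \<and> j \<le> hi \<and> j \<le> c + M * card (S \<inter> {c..<j})}"
  consider "hi \<le> lo" | "lo < hi" "lo \<notin> ?R lo" | "lo \<in> ?R lo" by linarith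
  then show ?case
  proof cases
    case 1
    then have "?R lo = {}" by auto
    then show ?thesis by (simp only: card.empty)
  next
    case 2
    then have "?R lo = ?R (Suc lo)" by (auto simp: Suc_le_eq order.order_iff_strict)
    then have "card (?R lo) \<le> M * card (S \<inter> {Suc lo..<hi})"
      using less[of "Suc lo"] 2 by simp
    also have "\<dots> \<le> M * card (S \<inter> {lo..<hi})" by (intro mult_le_mono2 card_mono) auto
    finally show ?thesis .
  next
    case 3
    then obtain j where j: "lo < j" "j \<le> hi" "j \<le> lo + M * card (S \<inter> {lo..<j})" by auto
    have "card (?R lo) \<le> card ({lo..<j} \<union> ?R j)" by (intro card_mono) auto
    also have "\<dots> \<le> (j - lo) + card (?R j)" by (rule card_Un_le[THEN order_trans]) simp
    also have "\<dots> \<le> M * card (S \<inter> {lo..<j}) + M * card (S \<inter> {j..<hi})"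
      using j less[of j] by linarith
    also have "\<dots> = M * card ((S \<inter> {lo..<j}) \<union> (S \<inter> {j..<hi}))"
      by (subst card_Un_disjoint) (auto simp: add_mult_distrib2)
    also have "(S \<inter> {lo..<j}) \<union> (S \<inter> {j..<hi}) = S \<inter> {lo..<hi}" using j by auto
    finally show ?thesis .
  qed
qed

text \<open>The mirror image, scanned from the right end. The exclusive bound is
  \<open>Suc c\<close>, so that \<open>c\<close> belongs to the interval.\<close>

lemma card_left_maximal:
  fixes lo hi M :: nat
  shows "card {c\<in>{lo..<hi}. \<exists>i. lo \<le> i \<and> i \<le> c \<and> Suc c \<le> i + M * card (S \<inter> {i..<Suc c})}
    \<le> M * card (S \<inter> {lo..<hi})"
proof (induction hi rule: less_induct)
  case (less hi)
  let ?L = "\<lambda>hi. {c\<in>{lo..<hi}. \<exists>i. lo \<le> i \<and> i \<le> c \<and> Suc c \<le> i + M * card (S \<inter> {i..<Suc c})}"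
  consider "hi \<le> lo" | c where "hi = Suc c" "c \<notin> ?L hi" | c where "hi = Suc c" "c \<in> ?L hi"
    by (cases hi) auto
  then show ?case
  proof cases
    case 1
    then have "?L hi = {}" by auto
    then show ?thesis by (simp only: card.empty)
  next
    case 2
    then have "?L hi = ?L c" by (auto simp: less_Suc_eq)
    then have "card (?L hi) \<le> M * card (S \<inter> {lo..<c})"
      using less[of c] 2 by simp
    also have "\<dots> \<le> M * card (S \<inter> {lo..<hi})" using 2 by (intro mult_le_mono2 card_mono) auto
    finally show ?thesis .
  next
    case 3
    then obtain i where i: "lo \<le> i" "i \<le> c" "Suc c \<le> i + M * card (S \<inter> {i..<Suc c})" by auto
    have "card (?L hi) \<le> card ({i..<hi} \<union> ?L i)" using 3 by (intro card_mono) auto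
    also have "\<dots> \<le> (hi - i) + card (?L i)" by (rule card_Un_le[THEN order_trans]) simp
    also have "\<dots> \<le> M * card (S \<inter> {i..<hi}) + M * card (S \<inter> {lo..<i})"
      using i less[of i] 3 by simp
    also have "\<dots> = M * card ((S \<inter> {i..<hi}) \<union> (S \<inter> {lo..<i}))"
      by (subst card_Un_disjoint) (auto simp: add_mult_distrib2)
    also have "(S \<inter> {i..<hi}) \<union> (S \<inter> {lo..<i}) = S \<inter> {lo..<hi}" using i 3 by auto
    finally show ?thesis .
  qed
qed

text \<open>An interval around \<open>c\<close> is cut at \<open>c\<close>. If \<open>S\<close> has
  density at least \<open>1 / K\<close> in it, then it has density at least
  \<open>1 / (2 * K)\<close> in one of the two parts, and the two one-sided bounds with
  \<open>2 * K\<close> add up to \<open>4 * K\<close>.\<close>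

lemma card_maximal:
  fixes lo hi K :: nat
  shows "card {c\<in>{lo..<hi}. \<exists>i j. lo \<le> i \<and> i \<le> c \<and> c < j \<and> j \<le> hi \<and> j \<le> i + K * card (S \<inter> {i..<j})}
    \<le> 4 * K * card (S \<inter> {lo..<hi})" (is "card ?D \<le> _")
proof -
  let ?R = "{c\<in>{lo..<hi}. \<exists>j. c < j \<and> j \<le> hi \<and> j \<le> c + (2 * K) * card (S \<inter> {c..<j})}"
  let ?L = "{c\<in>{lo..<hi}. \<exists>i. lo \<le> i \<and> i \<le> c \<and> Suc c \<le> i + (2 * K) * card (S \<inter> {i..<Suc c})}"
  have "?D \<subseteq> ?L \<union> ?R"
  proof
    fix c assume "c \<in> ?D"
    then obtain i j where ij: "lo \<le> i" "i \<le> c" "c < j" "j \<le> hi" "j \<le> i + K * card (S \<inter> {i..<j})"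
      and c: "c \<in> {lo..<hi}" by blast
    have "S \<inter> {i..<j} = (S \<inter> {i..<Suc c}) \<union> (S \<inter> {c..<j})" using ij by auto
    then have "card (S \<inter> {i..<j}) \<le> card (S \<inter> {i..<Suc c}) + card (S \<inter> {c..<j})"
      by (metis card_Un_le)
    then have "K * card (S \<inter> {i..<j}) \<le> K * card (S \<inter> {i..<Suc c}) + K * card (S \<inter> {c..<j})"
      by (metis add_mult_distrib2 mult_le_mono2)
    then have "Suc c \<le> i + (2 * K) * card (S \<inter> {i..<Suc c}) \<or> j \<le> c + (2 * K) * card (S \<inter> {c..<j})"
      using ij by linarith
    then show "c \<in> ?L \<union> ?R" using ij c by blast
  qed
  then have "card ?D \<le> card (?L \<union> ?R)" by (rule card_mono[rotated]) simp
  also have "\<dots> \<le> card ?L + card ?R" by (rule card_Un_le)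
  finally have "card ?D \<le> card ?L + card ?R" .
  with card_left_maximal[of lo hi "2 * K" S] card_right_maximal[of lo hi "2 * K" S]
  show ?thesis by linarith
qed

text \<open>The subcells of level \<open>s\<close> of the cell \<open>b\<close> of level
  \<open>t\<close>, for \<open>t \<le> s\<close>.\<close>

definition block :: "nat \<Rightarrow> nat \<Rightarrow> nat \<Rightarrow> nat set" where
  "block t s b = {c. c div 2 ^ (s - t) = b}"

lemma block_eq: "block t s b = {b * 2 ^ (s - t)..<Suc b * 2 ^ (s - t)}"
proof -
  have "c div 2 ^ (s - t) = b \<longleftrightarrow> b \<le> c div 2 ^ (s - t) \<and> c div 2 ^ (s - t) < Suc b" for c by auto
  then show ?thesis
    by (simp only: block_def set_eq_iff mem_Collect_eq atLeastLessThan_iff less_eq_div_iff_mult_less_eq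
        div_less_iff_less_mult zero_less_power zero_less_numeral simp_thms)
qed

lemma finite_block [simp]: "finite (block t s b)" and card_block: "card (block t s b) = 2 ^ (s - t)"
  by (simp_all add: block_eq)

lemma div_power_div_power:
  "t \<le> u \<Longrightarrow> u \<le> s \<Longrightarrow> (c div 2 ^ (s - u)) div 2 ^ (u - t) = c div (2::nat) ^ (s - t)"
  by (simp add: div_mult2_eq[symmetric] power_add[symmetric])

lemma card_vimage_div:
  assumes "finite S" "0 < D"
  shows "card {x. x div D \<in> S} = card S * (D::nat)"
proof -
  have "bij_betw (\<lambda>(a, r). a * D + r) (S \<times> {..<D}) {x. x div D \<in> S}"
    by (rule bij_betw_byWitness[where f' = "\<lambda>x. (x div D, x mod D)"]) (use assms in auto)
  then show ?thesis using bij_betw_same_card by (fastforce simp: card_cartesian_product)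
qed

text \<open>The dyadic cell \<open>[c / 2\<^sup>s, (c + 1) / 2\<^sup>s)\<close> is dead at stage \<open>s\<close> if it is then known to be disjoint from
  the closed class.\<close>
locale dead_cells =
  fixes dead :: "nat \<Rightarrow> nat \<Rightarrow> bool" and K :: nat
  assumes dead_div2: "dead s (c div 2) \<Longrightarrow> dead (Suc s) c"
begin

lemma dead_mono: "s \<le> s' \<Longrightarrow> dead s (c div 2 ^ (s' - s)) \<Longrightarrow> dead s' c"
proof (induction s' arbitrary: c rule: dec_induct)
  case (step n)
  have "c div 2 ^ (Suc n - s) = (c div 2) div 2 ^ (n - s)"
    using step.hyps by (simp add: Suc_diff_le div_mult2_eq)
  with step show ?case by (metis dead_div2)
qed simp

text \<open>Inside the cell of level \<open>t\<close> that contains the cell \<open>c\<close> of level \<open>s\<close>, some interval around \<open>c\<close>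
  has at least the fraction \<open>1 / K\<close> of its subcells of level \<open>s\<close> dead.\<close>
definition drop_at :: "nat \<Rightarrow> nat \<Rightarrow> nat \<Rightarrow> bool" where
  "drop_at t s c \<longleftrightarrow>
     (\<exists>i<Suc c. \<exists>j<Suc (Suc (c div 2 ^ (s - t)) * 2 ^ (s - t)).
        c div 2 ^ (s - t) * 2 ^ (s - t) \<le> i \<and> c < j \<and> j \<le> i + K * card {x. x < j \<and> (i \<le> x \<and> dead s x)})"

text \<open>Both ends of the interval in \<open>drop_at\<close> are confined to the cell of level
  \<open>t\<close>, so the maximal inequality can be used inside the block and charges only dead
  cells of that block.\<close>

lemma card_drop_at:
  "card {c\<in>block t s b. drop_at t s c} \<le> 4 * K * card {c\<in>block t s b. dead s c}"
proof -
  let ?lo = "b * 2 ^ (s - t)" and ?hi = "Suc b * 2 ^ (s - t)" and ?S = "Collect (dead s)"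
  have eq: "{x. x < j \<and> (i \<le> x \<and> dead s x)} = ?S \<inter> {i..<j}" for i j by auto
  have "{c\<in>block t s b. drop_at t s c} \<subseteq>
     {c\<in>{?lo..<?hi}. \<exists>i j. ?lo \<le> i \<and> i \<le> c \<and> c < j \<and> j \<le> ?hi \<and> j \<le> i + K * card (?S \<inter> {i..<j})}"
  proof
    fix c assume "c \<in> {c\<in>block t s b. drop_at t s c}"
    then have c: "c \<in> block t s b" and "drop_at t s c" by auto
    moreover have "c div 2 ^ (s - t) = b" using c by (simp add: block_def)
    ultimately obtain i j where "i < Suc c" "j < Suc ?hi" "?lo \<le> i" "c < j"
      "j \<le> i + K * card (?S \<inter> {i..<j})"
      unfolding drop_at_def eq by auto
    then show "c \<in> {c\<in>{?lo..<?hi}. \<exists>i j. ?lo \<le> i \<and> i \<le> c \<and> c < j \<and> j \<le> ?hi \<and> j \<le> i + K * card (?S \<inter> {i..<j})}"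
      using c unfolding block_eq less_Suc_eq_le by blast
  qed
  then have "card {c\<in>block t s b. drop_at t s c} \<le> 4 * K * card (?S \<inter> {?lo..<?hi})"
    by (intro order_trans[OF card_mono card_maximal]) auto
  also have "?S \<inter> {?lo..<?hi} = {c\<in>block t s b. dead s c}" unfolding block_eq by auto
  finally show ?thesis .
qed

text \<open>Passing from \<open>s\<close> to \<open>s'\<close> multiplies both ends of the interval
  by \<open>D\<close> and splits each dead cell into \<open>D\<close> dead cells, so the density
  does not decrease; passing from \<open>t\<close> to \<open>t'\<close> only enlarges the cell that
  has to contain the interval. This carries drops between consecutive values of the dominating
  function over to the stages of an oracle.\<close>

lemma drop_at_mono:
  assumes "drop_at t s (c div 2 ^ (s' - s))" "t' \<le> t" "t \<le> s" "s \<le> s'"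
  shows "drop_at t' s' c"
proof -
  define D where "D = (2::nat) ^ (s' - s)"
  define m where "m = (2::nat) ^ (s - t)"
  define r where "r = (2::nat) ^ (t - t')"
  define b where "b = c div D div m"
  have D: "0 < D" by (simp add: D_def)
  obtain i j where i: "i \<le> c div D" and j: "j \<le> Suc b * m"
    and ij: "b * m \<le> i" "c div D < j" "j \<le> i + K * card {x. x < j \<and> (i \<le> x \<and> dead s x)}"
    using assms(1) unfolding drop_at_def D_def[symmetric] m_def[symmetric] b_def less_Suc_eq_le by blast
  have pow: "2 ^ (s' - t') = D * m * r"
    using assms(2-4) by (simp add: D_def m_def r_def power_add[symmetric])
  have b': "c div (D * m * r) = b div r" unfolding b_def by (simp add: div_mult2_eq)
  have "b div r * (D * m * r) = (b div r * r) * m * D" by simp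
  also have "\<dots> \<le> b * m * D" by (intro mult_le_mono1) simp
  also have "\<dots> \<le> i * D" using ij(1) by (intro mult_le_mono1)
  finally have 1: "b div r * (D * m * r) \<le> i * D" .
  have "b < Suc (b div r) * r" using dividend_less_div_times[of r b] by (simp add: r_def)
  then have "j \<le> (Suc (b div r) * r) * m" using j by (meson Suc_leI le_trans mult_le_mono1)
  then have "j * D \<le> (Suc (b div r) * r) * m * D" by (rule mult_le_mono1)
  then have 2: "j * D \<le> Suc (b div r) * (D * m * r)" by (simp only: ac_simps)
  have 3: "i * D \<le> c" using i D by (metis less_eq_div_iff_mult_less_eq)
  have 4: "c < j * D" using ij(2) D by (metis div_less_iff_less_mult)
  have "j * D \<le> (i + K * card {x. x < j \<and> (i \<le> x \<and> dead s x)}) * D" using ij(3) by (rule mult_le_mono1)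
  also have "\<dots> = i * D + K * card {x. x div D \<in> {x. x < j \<and> (i \<le> x \<and> dead s x)}}"
    using D by (subst card_vimage_div) (auto simp: algebra_simps)
  also have "\<dots> \<le> i * D + K * card {x. x < j * D \<and> (i * D \<le> x \<and> dead s' x)}"
  proof (intro add_left_mono mult_le_mono2 card_mono)
    show "{x. x div D \<in> {x. x < j \<and> (i \<le> x \<and> dead s x)}} \<subseteq> {x. x < j * D \<and> (i * D \<le> x \<and> dead s' x)}"
      using D dead_mono[OF assms(4)] unfolding D_def
      by (auto simp: less_eq_div_iff_mult_less_eq div_less_iff_less_mult)
  qed auto
  finally have 5: "j * D \<le> i * D + K * card {x. x < j * D \<and> (i * D \<le> x \<and> dead s' x)}" .
  show ?thesis
    unfolding drop_at_def pow b' less_Suc_eq_le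
    by (rule exI[of _ "i * D"], rule conjI[OF 3], rule exI[of _ "j * D"]) (intro conjI 1 2 4 5)
qed

text \<open>\<open>n\<close> is the number of drops still owed: each survived drop lowers it, and
  once it is 0 the cell has won, whatever happens to it afterwards. Because of this stopping rule a
  win along a prefix of the stages is a win along the whole list.\<close>

fun win :: "nat \<Rightarrow> nat \<Rightarrow> nat list \<Rightarrow> nat \<Rightarrow> nat \<Rightarrow> bool" where
  "win n t [] s c \<longleftrightarrow> n = 0"
| "win n t (u # us) s c \<longleftrightarrow> n = 0 \<or> \<not> dead u (c div 2 ^ (s - u)) \<and>
     win (if drop_at t u (c div 2 ^ (s - u)) then n - 1 else n) u us s c"

lemma win_0: "win 0 t us s c"
  by (cases us) auto

lemma win_append: "win n t us s c \<Longrightarrow> win n t (us @ vs) s c"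
  by (induction us arbitrary: n t) (auto simp: win_0)

definition ratio :: real where
  "ratio = 4 * K / (4 * K + 1)"

lemma ratio: "0 \<le> ratio" "ratio < 1"
  by (auto simp: ratio_def)

text \<open>Survivors of a drop gain the factor \<open>1 / ratio = 1 + 1 / (4 K)\<close>, which the weak-type
  inequality balances against the mass lost to dead cells.\<close>
lemma sum_block_le:
  assumes "0 < n"
  shows "(\<Sum>d\<in>block t u b. if dead u d then 0 else if drop_at t u d then ratio ^ (n - 1) else ratio ^ n)
    \<le> ratio ^ n * 2 ^ (u - t)"
proof -
  obtain k where n: "n = Suc k" using assms by (cases n) auto
  let ?B = "block t u b"
  let ?E = "{d\<in>?B. dead u d}" and ?P = "{d\<in>?B. drop_at t u d}"
  have "(\<Sum>d\<in>?B. if dead u d then 0 else if drop_at t u d then ratio ^ (n - 1) else ratio ^ n)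
    \<le> (\<Sum>d\<in>?B. ratio ^ n * (1 - of_bool (dead u d)) + (ratio ^ k - ratio ^ n) * of_bool (drop_at t u d))"
  proof (rule sum_mono)
    fix d
    have "ratio ^ n \<le> ratio ^ k" using ratio by (simp add: n mult_le_cancel_right2)
    then show "(if dead u d then 0 else if drop_at t u d then ratio ^ (n - 1) else ratio ^ n)
      \<le> ratio ^ n * (1 - of_bool (dead u d)) + (ratio ^ k - ratio ^ n) * of_bool (drop_at t u d)"
      using ratio by (auto simp: n)
  qed
  also have "\<dots> = ratio ^ n * (real (card ?B) - real (card ?E)) + (ratio ^ k - ratio ^ n) * card ?P"
    by (simp add: sum.distrib sum_distrib_left[symmetric] sum_subtractf sum.If_cases of_bool_def Int_def)
  also have "\<dots> \<le> ratio ^ n * (real (card ?B) - real (card ?E)) + (ratio ^ k - ratio ^ n) * (4 * K * card ?E)"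
  proof -
    have "real (card ?P) \<le> real (4 * K * card ?E)" using card_drop_at by (simp only: of_nat_le_iff)
    moreover have "ratio ^ n \<le> ratio ^ k" using ratio by (simp add: n mult_le_cancel_right2)
    ultimately show ?thesis by (intro add_left_mono mult_left_mono) auto
  qed
  also have "\<dots> = ratio ^ n * card ?B + ratio ^ k * card ?E * ((1 - ratio) * (4 * K) - ratio)"
    by (simp add: n algebra_simps)
  \<comment> \<open>The equation that determines \<open>ratio\<close>: the gain at drops and the
    loss to dead cells cancel.\<close>
  also have "(1 - ratio) * (4 * K) - ratio = 0"
    by (simp add: ratio_def field_simps)
  finally show ?thesis by (simp add: card_block)
qed

text \<open>The supermartingale has value \<open>ratio ^ n\<close> when \<open>n\<close> drops are
  owed. The induction hypothesis bounds each subcell of level \<open>u\<close> by this value for its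
  own remaining \<open>n\<close>, and \<open>sum_block_le\<close> says that the average over the
  block does not exceed the old value.\<close>

lemma card_win_block:
  assumes "sorted_wrt (<) (t # us)" "\<forall>u\<in>set (t # us). u \<le> s"
  shows "card {c\<in>block t s b. win n t us s c} \<le> ratio ^ n * 2 ^ (s - t)"
  using assms
proof (induction us arbitrary: n t b)
  case Nil
  show ?case using ratio by (cases "n = 0") (auto simp: card_block)
next
  case (Cons u us)
  show ?case
  proof (cases "n = 0")
    case True
    then show ?thesis by (simp add: card_block)
  next
    case False
    have tu: "t < u" "u \<le> s" using Cons.prems by auto
    let ?W = "\<lambda>d. {c\<in>block u s d. win n t (u # us) s c}"
    have le: "card (?W d) \<le> (if dead u d then 0 else if drop_at t u d then ratio ^ (n - 1) else ratio ^ n) * 2 ^ (s - u)" for d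
    proof -
      have "?W d = (if dead u d then {} else {c\<in>block u s d. win (if drop_at t u d then n - 1 else n) u us s c})"
        using False by (auto simp: block_def)
      then show ?thesis
        using Cons.IH[of u d "if drop_at t u d then n - 1 else n"] Cons.prems by auto
    qed
    have "{c\<in>block t s b. win n t (u # us) s c} \<subseteq> (\<Union>d\<in>block t u b. ?W d)"
      using div_power_div_power[of t u s] tu by (auto simp: block_def)
    then have "card {c\<in>block t s b. win n t (u # us) s c} \<le> card (\<Union>d\<in>block t u b. ?W d)"
      by (intro card_mono) auto
    also have "\<dots> \<le> (\<Sum>d\<in>block t u b. card (?W d))" by (intro card_UN_le) simp
    finally have "real (card {c\<in>block t s b. win n t (u # us) s c}) \<le> (\<Sum>d\<in>block t u b. real (card (?W d)))"
      by (simp only: of_nat_sum[symmetric] of_nat_le_iff)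
    also have "\<dots> \<le> (\<Sum>d\<in>block t u b. (if dead u d then 0 else if drop_at t u d then ratio ^ (n - 1) else ratio ^ n) * 2 ^ (s - u))"
      by (intro sum_mono le)
    also have "\<dots> \<le> (ratio ^ n * 2 ^ (u - t)) * 2 ^ (s - u)"
      unfolding sum_distrib_right[symmetric] using False by (intro mult_right_mono sum_block_le) auto
    also have "\<dots> = ratio ^ n * 2 ^ (s - t)"
      using tu by (simp add: power_add[symmetric])
    finally show ?thesis .
  qed
qed

definition drops :: "(nat \<Rightarrow> nat) \<Rightarrow> nat \<Rightarrow> nat \<Rightarrow> nat \<Rightarrow> nat" where
  "drops T k s c = card {i. i < k \<and> drop_at (T i) (T (Suc i)) (c div 2 ^ (s - T (Suc i)))}"

text \<open>Death persists, so a cell that is alive at the last stage was alive at all earlier ones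
  and has survived every drop that \<open>drops\<close> counts.\<close>

lemma drops_imp_win:
  assumes "\<And>i. i < k \<Longrightarrow> T i < T (Suc i)" "T k \<le> s" "\<not> dead (T k) (c div 2 ^ (s - T k))"
    and "n \<le> drops T k s c"
  shows "win n (T 0) (map T [Suc 0..<Suc k]) s c"
proof -
  have mono: "T i \<le> T k" if "i \<le> k" for i
    using that
  proof (induction rule: inc_induct)
    case (step m)
    then show ?case using assms(1)[of m] by simp
  qed simp
  have alive: "\<not> dead (T i) (c div 2 ^ (s - T i))" if "i \<le> k" for i
  proof
    assume "dead (T i) (c div 2 ^ (s - T i))"
    then have "dead (T i) (c div 2 ^ (s - T k) div 2 ^ (T k - T i))"
      using div_power_div_power[of "T i" "T k" s c] mono[OF that] assms(2) by simp
    then show False using dead_mono mono[OF that] assms(3) by blast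
  qed
  \<comment> \<open>Generalised to a start at stage \<open>m\<close>, for an induction downwards
    from \<open>k\<close>.\<close>
  have "win n (T m) (map T [Suc m..<Suc k]) s c"
    if "m \<le> k" "n \<le> card {i. m \<le> i \<and> i < k \<and> drop_at (T i) (T (Suc i)) (c div 2 ^ (s - T (Suc i)))}" for m n
    using that
  proof (induction arbitrary: n rule: inc_induct)
    case base
    have "{i. k \<le> i \<and> i < k \<and> drop_at (T i) (T (Suc i)) (c div 2 ^ (s - T (Suc i)))} = {}" by auto
    with base have "n = 0" by (simp only: card.empty)
    then show ?case by (simp add: win_0)
  next
    case (step m)
    let ?d = "\<lambda>i. drop_at (T i) (T (Suc i)) (c div 2 ^ (s - T (Suc i)))"
    have "{i. m \<le> i \<and> i < k \<and> ?d i} = (if ?d m then {m} else {}) \<union> {i. Suc m \<le> i \<and> i < k \<and> ?d i}"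
      using step.hyps by (auto simp: le_less Suc_le_eq)
    then have "card {i. m \<le> i \<and> i < k \<and> ?d i} = (if ?d m then 1 else 0) + card {i. Suc m \<le> i \<and> i < k \<and> ?d i}"
      by (auto simp: card_insert_if)
    then have "(if ?d m then n - 1 else n) \<le> card {i. Suc m \<le> i \<and> i < k \<and> ?d i}"
      using step.prems by auto
    moreover have "[Suc m..<Suc k] = Suc m # [Suc (Suc m)..<Suc k]"
      using step.hyps by (simp add: upt_conv_Cons del: upt_Suc)
    ultimately show ?case
      using step.IH alive[of "Suc m"] step.hyps by (simp del: upt_Suc)
  qed
  from this[of 0 n] assms(4) show ?thesis by (simp add: drops_def)
qed

text \<open>The choice of \<open>k'\<close> costs nothing in measure, since winning along the first
  \<open>k'\<close> stages is winning along all \<open>k\<close>. Summing the block bound over the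
  \<open>2 ^ T 0\<close> cells of the initial level gives the unit interval.\<close>

lemma card_drops_le:
  assumes T: "\<And>i. i < k \<Longrightarrow> T i < T (Suc i)" and s: "T k \<le> s"
  shows "card {c. c < 2 ^ s \<and> (\<exists>k'\<le>k. \<not> dead (T k') (c div 2 ^ (s - T k')) \<and> n \<le> drops T k' s c)}
    \<le> ratio ^ n * 2 ^ s" (is "real (card ?A) \<le> _")
proof -
  have less: "T i < T j" if "i < j" "j \<le> k" for i j
    using that
  proof (induction j)
    case (Suc j)
    then show ?case using T[of j] by (cases "i = j") auto
  qed simp
  then have le: "T i \<le> T j" if "i \<le> j" "j \<le> k" for i j
    using that by (cases "i = j") (auto simp: less_imp_le)
  let ?us = "map T [Suc 0..<Suc k]"
  let ?W = "\<lambda>b. {c\<in>block (T 0) s b. win n (T 0) ?us s c}"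
  have win: "win n (T 0) ?us s c"
    if "k' \<le> k" "\<not> dead (T k') (c div 2 ^ (s - T k'))" "n \<le> drops T k' s c" for k' c
  proof -
    have "T k' \<le> s" using le[of k' k] that(1) s by simp
    then have "win n (T 0) (map T [Suc 0..<Suc k']) s c"
      by (intro drops_imp_win that T) (use that(1) in auto)
    moreover have "?us = map T [Suc 0..<Suc k'] @ map T [Suc k'..<Suc k]"
      using that(1) upt_add_eq_append[of "Suc 0" "Suc k'" "k - k'"]
      by (simp del: upt_Suc flip: map_append)
    ultimately show ?thesis using win_append by metis
  qed
  have "?A \<subseteq> (\<Union>b\<in>{..<2 ^ T 0}. ?W b)"
  proof
    fix c assume c: "c \<in> ?A"
    then have "win n (T 0) ?us s c" using win by blast
    moreover have "c div 2 ^ (s - T 0) < 2 ^ T 0"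
      using c le[of 0 k] s by (simp add: div_less_iff_less_mult power_add[symmetric])
    ultimately show "c \<in> (\<Union>b\<in>{..<2 ^ T 0}. ?W b)" by (auto simp: block_def)
  qed
  then have "card ?A \<le> card (\<Union>b\<in>{..<2 ^ T 0}. ?W b)" by (intro card_mono) auto
  also have "\<dots> \<le> (\<Sum>b\<in>{..<2 ^ T 0}. card (?W b))" by (intro card_UN_le) simp
  finally have "real (card ?A) \<le> (\<Sum>b\<in>{..<2 ^ T 0}. real (card (?W b)))"
    by (simp only: of_nat_sum[symmetric] of_nat_le_iff)
  also have "\<dots> \<le> (\<Sum>b\<in>{..<(2::nat) ^ T 0}. ratio ^ n * 2 ^ (s - T 0))"
  proof (intro sum_mono card_win_block)
    show "sorted_wrt (<) (T 0 # ?us)"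
      by (auto simp: sorted_wrt_iff_nth_less nth_Cons' intro!: less simp del: upt_Suc)
    show "\<forall>u\<in>set (T 0 # ?us). u \<le> s"
      using s by (auto simp del: upt_Suc intro!: order_trans[OF le[of _ k] s])
  qed
  also have "\<dots> = ratio ^ n * 2 ^ s"
    using le[of 0 k] s by (simp add: power_add[symmetric])
  finally show ?thesis .
qed

end

subsection \<open>Averaging over the oracle\<close>

lemma prob_space_cantor: "prob_space cantor_measure"
  unfolding cantor_measure_def by (intro prob_space_PiM prob_space_measure_pmf)

lemma space_cantor [simp]: "space cantor_measure = UNIV"
  by (simp add: cantor_measure_def space_PiM PiE_UNIV_domain)

lemma prefix_code_cong: "(\<And>i. i < s \<Longrightarrow> A i = B i) \<Longrightarrow> prefix_code A s = prefix_code B s"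
  unfolding prefix_code_def by (intro sum.cong) auto

lemma prefix_code_digits: "prefix_code (\<lambda>i. odd (\<sigma> div 2 ^ i)) s = \<sigma> mod 2 ^ s"
proof (induction s)
  case (Suc s)
  have "\<sigma> mod 2 ^ Suc s = 2 ^ s * (\<sigma> div 2 ^ s mod 2) + \<sigma> mod 2 ^ s"
    by (metis mod_mult2_eq mult.commute power_Suc)
  then show ?case using Suc by (simp add: prefix_code_Suc odd_iff_mod_2_eq_one of_bool_odd_eq_mod_2)
qed (simp add: prefix_code_def)

lemma prefix_code_eq_iff:
  assumes "\<sigma> < 2 ^ s"
  shows "prefix_code A s = \<sigma> \<longleftrightarrow> (\<forall>i<s. A i = odd (\<sigma> div 2 ^ i))"
proof
  assume "prefix_code A s = \<sigma>"
  then show "\<forall>i<s. A i = odd (\<sigma> div 2 ^ i)"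
    using prefix_code_bit[of _ s A] by (auto simp: odd_iff_mod_2_eq_one even_iff_mod_2_eq_zero)
next
  assume "\<forall>i<s. A i = odd (\<sigma> div 2 ^ i)"
  then have "prefix_code A s = prefix_code (\<lambda>i. odd (\<sigma> div 2 ^ i)) s" by (intro prefix_code_cong) auto
  then show "prefix_code A s = \<sigma>" using assms by (simp add: prefix_code_digits)
qed

lemma cylinder:
  shows "{A. \<forall>i<s. A i = \<tau> i} \<in> sets cantor_measure"
    and "measure cantor_measure {A. \<forall>i<s. A i = \<tau> i} = 1 / 2 ^ s"
proof -
  let ?M = "\<lambda>_::nat. measure_pmf (bernoulli_pmf (1 / 2))"
  interpret product_prob_space ?M UNIV by (intro product_prob_spaceI prob_space_measure_pmf)
  have eq: "{A. \<forall>i<s. A i = \<tau> i} = prod_emb UNIV ?M {..<s} (\<Pi>\<^sub>E i\<in>{..<s}. {\<tau> i})"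
    by (simp add: prod_emb_def set_eq_iff restrict_PiE_iff Pi_iff Ball_def PiE_UNIV_domain)
  show "{A. \<forall>i<s. A i = \<tau> i} \<in> sets cantor_measure"
    unfolding eq cantor_measure_def by (intro sets_PiM_I) auto
  have "measure cantor_measure {A. \<forall>i<s. A i = \<tau> i} = (\<Prod>i\<in>{..<s}. measure (?M i) {\<tau> i})"
    unfolding eq cantor_measure_def by (intro measure_PiM_emb) auto
  also have "\<dots> = (\<Prod>i\<in>{..<s}. 1 / 2)"
    by (intro prod.cong) (auto simp: measure_pmf_single pmf_bernoulli_half)
  finally show "measure cantor_measure {A. \<forall>i<s. A i = \<tau> i} = 1 / 2 ^ s"
    by (simp add: power_one_over)
qed

lemma cantor_prefix_code:
  shows "{A. P (prefix_code A s)} \<in> sets cantor_measure"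
    and "measure cantor_measure {A. P (prefix_code A s)} = card {\<sigma>. \<sigma> < 2 ^ s \<and> P \<sigma>} / 2 ^ s"
proof -
  interpret prob_space cantor_measure by (rule prob_space_cantor)
  let ?I = "{\<sigma>. \<sigma> < 2 ^ s \<and> P \<sigma>}"
  let ?C = "\<lambda>\<sigma>. {A. prefix_code A s = \<sigma>}"
  have C: "?C \<sigma> = {A. \<forall>i<s. A i = odd (\<sigma> div 2 ^ i)}" if "\<sigma> \<in> ?I" for \<sigma>
    using that prefix_code_eq_iff by auto
  have sets: "?C \<sigma> \<in> sets cantor_measure" and meas: "measure cantor_measure (?C \<sigma>) = 1 / 2 ^ s"
    if "\<sigma> \<in> ?I" for \<sigma>
    unfolding C[OF that] by (rule cylinder)+
  have eq: "{A. P (prefix_code A s)} = (\<Union>\<sigma>\<in>?I. ?C \<sigma>)" using prefix_code_less by auto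
  show "{A. P (prefix_code A s)} \<in> sets cantor_measure"
    unfolding eq by (intro sets.finite_UN sets) auto
  have "measure cantor_measure {A. P (prefix_code A s)} = (\<Sum>\<sigma>\<in>?I. measure cantor_measure (?C \<sigma>))"
    unfolding eq by (intro finite_measure_finite_Union) (use sets in \<open>auto simp: disjoint_family_on_def\<close>)
  also have "\<dots> = card ?I / 2 ^ s" using meas by simp
  finally show "measure cantor_measure {A. P (prefix_code A s)} = card ?I / 2 ^ s" .
qed

text \<open>\<open>beval\<close> returns successors, so once the values have converged to those of
  \<open>h\<close> this is the sum of \<open>h n + 1\<close> over \<open>n \<le> 2 * k\<close>. It
  increases strictly in \<open>k\<close> and bounds all these \<open>h n\<close>.\<close>

definition stage :: "prog \<Rightarrow> nat \<Rightarrow> nat \<Rightarrow> nat \<Rightarrow> nat" where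
  "stage p \<sigma> s k = (\<Sum>n<Suc (2 * k). beval p \<sigma> s [n])"

definition defined_upto :: "prog \<Rightarrow> nat \<Rightarrow> nat \<Rightarrow> nat \<Rightarrow> bool" where
  "defined_upto p \<sigma> s k \<longleftrightarrow> (\<forall>n<Suc (2 * k). \<not> beval p \<sigma> s [n] = 0)"

lemma recfun_stage:
  assumes "recfun B l F" "recfun B l G" "recfun B l H"
  shows "recfun B l (\<lambda>xs. stage p (F xs) (G xs) (H xs))"
  by (rule recfun_comp3[OF _ assms], unfold stage_def)
     (intro recfun_sum recfun_beval_unary recfun_intros; simp)

lemma recfun_defined_upto:
  assumes "recfun B l F" "recfun B l G" "recfun B l H"
  shows "recfun B l (\<lambda>xs. of_bool (defined_upto p (F xs) (G xs) (H xs)))"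
  by (rule recfun_comp3[where h = "\<lambda>x y z. of_bool (defined_upto p x y z)", OF _ assms], unfold defined_upto_def)
     (intro recfun_all recfun_not recfun_eq recfun_beval_unary recfun_intros; simp)

lemma stage_Suc: "stage p \<sigma> s (Suc k) = stage p \<sigma> s k + beval p \<sigma> s [Suc (2 * k)] + beval p \<sigma> s [Suc (Suc (2 * k))]"
  by (simp add: stage_def)

lemma stage_less: "defined_upto p \<sigma> s k \<Longrightarrow> i < k \<Longrightarrow> stage p \<sigma> s i < stage p \<sigma> s (Suc i)"
  unfolding stage_Suc defined_upto_def by auto

lemma stage_extend:
  assumes "s \<le> s'" "\<And>x. x < s \<Longrightarrow> (\<sigma>' div 2 ^ x) mod 2 = (\<sigma> div 2 ^ x) mod (2::nat)"
    and "defined_upto p \<sigma> s k"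
  shows "defined_upto p \<sigma>' s' k" "i \<le> k \<Longrightarrow> stage p \<sigma>' s' i = stage p \<sigma> s i"
proof -
  have eq: "beval p \<sigma>' s' [n] = beval p \<sigma> s [n]" if "n < Suc (2 * k)" for n
    using beval_mono[OF assms(1,2), of p "[n]" "beval p \<sigma> s [n] - 1"] assms(3) that
    by (auto simp: defined_upto_def)
  show "defined_upto p \<sigma>' s' k" using assms(3) eq by (simp add: defined_upto_def)
  show "stage p \<sigma>' s' i = stage p \<sigma> s i" if "i \<le> k"
    unfolding stage_def using that by (intro sum.cong eq) auto
qed

context dead_cells
begin

text \<open>With \<open>\<sigma>\<close> as initial segment of the oracle, \<open>p\<close> reveals within \<open>s\<close> steps a sequence of stages along which
  the cell \<open>c\<close> of level \<open>s\<close> survives at least \<open>n\<close> drops.\<close>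
definition caught :: "prog \<Rightarrow> nat \<Rightarrow> nat \<Rightarrow> nat \<Rightarrow> nat \<Rightarrow> bool" where
  "caught p n s \<sigma> c \<longleftrightarrow> (\<exists>k<Suc s. defined_upto p \<sigma> s k \<and> stage p \<sigma> s k \<le> s \<and>
     \<not> dead (stage p \<sigma> s k) (c div 2 ^ (s - stage p \<sigma> s k)) \<and> n \<le> drops (stage p \<sigma> s) k s c)"

lemma card_caught_le: "card {c. c < 2 ^ s \<and> caught p n s \<sigma> c} \<le> ratio ^ n * 2 ^ s"
proof -
  let ?K = "{k. k < Suc s \<and> defined_upto p \<sigma> s k \<and> stage p \<sigma> s k \<le> s}"
  show ?thesis
  proof (cases "?K = {}")
    case True
    then have "{c. c < 2 ^ s \<and> caught p n s \<sigma> c} = {}" by (auto simp: caught_def)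
    then show ?thesis using ratio by (simp only: card.empty) simp
  next
    case False
    have fin: "finite ?K" by auto
    \<comment> \<open>All admissible indices are prefixes of one sequence of stages, so the largest
      one covers them.\<close>
    define k where "k = Max ?K"
    have k: "k \<in> ?K" unfolding k_def using False fin by (intro Max_in)
    have "{c. c < 2 ^ s \<and> caught p n s \<sigma> c} \<subseteq> {c. c < 2 ^ s \<and> (\<exists>k'\<le>k. \<not> dead (stage p \<sigma> s k')
        (c div 2 ^ (s - stage p \<sigma> s k')) \<and> n \<le> drops (stage p \<sigma> s) k' s c)}"
      using Max_ge[OF fin] unfolding caught_def k_def by blast
    then have "card {c. c < 2 ^ s \<and> caught p n s \<sigma> c} \<le> card {c. c < 2 ^ s \<and> (\<exists>k'\<le>k. \<not> dead (stage p \<sigma> s k')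
        (c div 2 ^ (s - stage p \<sigma> s k')) \<and> n \<le> drops (stage p \<sigma> s) k' s c)}"
      by (intro card_mono) auto
    also have "real \<dots> \<le> ratio ^ n * 2 ^ s"
      using k stage_less by (intro card_drops_le) auto
    finally show ?thesis by simp
  qed
qed

text \<open>All stages involved are at most \<open>s\<close>, where \<open>c\<close> and
  \<open>c div 2\<close> have the same ancestors, and the values already found do not change when
  the oracle prefix grows.\<close>

lemma caught_mono:
  assumes "caught p n s \<sigma> (c div 2)" "\<And>x. x < s \<Longrightarrow> (\<sigma>' div 2 ^ x) mod 2 = (\<sigma> div 2 ^ x) mod 2"
  shows "caught p n (Suc s) \<sigma>' c"
proof -
  from assms(1) obtain k where k: "k < Suc s" "defined_upto p \<sigma> s k" "stage p \<sigma> s k \<le> s"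
    "\<not> dead (stage p \<sigma> s k) (c div 2 div 2 ^ (s - stage p \<sigma> s k))"
    "n \<le> drops (stage p \<sigma> s) k s (c div 2)"
    unfolding caught_def by blast
  note ext = stage_extend[where s' = "Suc s", OF _ assms(2) k(2), simplified]
  have div: "c div 2 div 2 ^ (s - t) = c div 2 ^ (Suc s - t)" if "t \<le> s" for t
    using that by (simp add: Suc_diff_le div_mult2_eq)
  have "stage p \<sigma> s (Suc i) \<le> s" if "i < k" for i
  proof -
    have "stage p \<sigma> s (Suc i) \<le> stage p \<sigma> s k"
      unfolding stage_def using that by (intro sum_mono2) auto
    with k(3) show ?thesis by simp
  qed
  then have "drops (stage p \<sigma>' (Suc s)) k (Suc s) c = drops (stage p \<sigma> s) k s (c div 2)"
    unfolding drops_def by (intro arg_cong[where f = card] Collect_cong conj_cong) (auto simp: ext(2) div)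
  then show ?thesis
    unfolding caught_def using k ext div[OF k(3)] by (intro exI[of _ k]) auto
qed

lemma recfun_drop_at:
  assumes D: "recfun B 2 (\<lambda>xs. of_bool (dead (xs ! 0) (xs ! 1)))"
    and "recfun B l F" "recfun B l G" "recfun B l H"
  shows "recfun B l (\<lambda>xs. of_bool (drop_at (F xs) (G xs) (H xs)))"
proof (rule recfun_comp3[where h = "\<lambda>x y z. of_bool (drop_at x y z)", OF _ assms(2-)])
  have dead: "recfun B l (\<lambda>xs. of_bool (dead (F xs) (G xs)))" if "recfun B l F" "recfun B l G" for l F G
    by (rule recfun_comp2[where h = "\<lambda>x y. of_bool (dead x y)", OF D that])
  show "recfun B 3 (\<lambda>xs. of_bool (drop_at (xs ! 0) (xs ! 1) (xs ! 2)))"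
    unfolding drop_at_def
    by (intro recfun_ex recfun_conj recfun_le recfun_less recfun_card dead recfun_intros) simp_all
qed

lemma recfun_caught:
  assumes D: "recfun B 2 (\<lambda>xs. of_bool (dead (xs ! 0) (xs ! 1)))"
    and "recfun B l F" "recfun B l G" "recfun B l H" "recfun B l I"
  shows "recfun B l (\<lambda>xs. of_bool (caught p (F xs) (G xs) (H xs) (I xs)))"
proof (rule recfun_comp4[where h = "\<lambda>x y z w. of_bool (caught p x y z w)", OF _ assms(2-)])
  have dead: "recfun B l (\<lambda>xs. of_bool (dead (F xs) (G xs)))" if "recfun B l F" "recfun B l G" for l F G
    by (rule recfun_comp2[where h = "\<lambda>x y. of_bool (dead x y)", OF D that])
  show "recfun B 4 (\<lambda>xs. of_bool (caught p (xs ! 0) (xs ! 1) (xs ! 2) (xs ! 3)))"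
    unfolding caught_def drops_def
    by (intro recfun_ex recfun_conj recfun_not recfun_le recfun_card recfun_defined_upto dead
        recfun_drop_at D recfun_stage recfun_div recfun_power2 recfun_diff recfun_intros) simp_all
qed

lemma ratio_power: "\<exists>J. ratio ^ J \<le> 1 / 2"
  using real_arch_pow_inv[of "1/2" ratio] ratio by (auto intro: less_imp_le)

text \<open>Double counting in the table of cells against oracle prefixes of length
  \<open>s\<close>: each prefix catches at most the fraction \<open>ratio ^ n\<close> of the cells,
  so the cells caught by more than \<open>1 / N\<close> of the prefixes have measure at most
  \<open>N * ratio ^ n\<close>. They form a test without oracle. Since \<open>z\<close> escapes one
  component, the oracles that catch it there have measure at most \<open>1 / N\<close>.\<close>

lemma AE_program:
  assumes z: "martin_loef_random z" "z \<in> {0..1}"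
    and D: "recfun empty_oracle 2 (\<lambda>xs. of_bool (dead (xs ! 0) (xs ! 1)))"
    and alive: "\<And>s. \<not> dead s (cell z s)"
  shows "AE A in cantor_measure. \<forall>h. (\<forall>n. computes A p [n] (h n)) \<longrightarrow>
    finite {k. drop_at (\<Sum>n<Suc (2 * k). Suc (h n)) (\<Sum>n<Suc (2 * Suc k). Suc (h n))
        (cell z (\<Sum>n<Suc (2 * Suc k). Suc (h n)))}"
proof -
  define bad where "bad = {A. \<exists>h. (\<forall>n. computes A p [n] (h n)) \<and>
    infinite {k. drop_at (\<Sum>n<Suc (2 * k). Suc (h n)) (\<Sum>n<Suc (2 * Suc k). Suc (h n))
        (cell z (\<Sum>n<Suc (2 * Suc k). Suc (h n)))}}"
  have z01: "0 \<le> z" using z(2) by simp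
  have cover: "\<exists>E. E \<in> sets cantor_measure \<and> bad \<subseteq> E \<and> emeasure cantor_measure E \<le> ennreal (1 / N)"
    if "0 < N" for N :: nat
  proof -
    interpret prob_space cantor_measure by (rule prob_space_cantor)
    obtain J where J: "ratio ^ J \<le> 1 / 2" using ratio_power by blast
    \<comment> \<open>With \<open>ratio ^ J \<le> 1 / 2\<close> this many drops give
      \<open>N * ratio ^ j m \<le> 1 / 2 ^ m\<close>, because \<open>N \<le> 2 ^ N\<close>.\<close>
    define j where "j m = J * (m + N)" for m
    define R where "R m s c \<longleftrightarrow> 2 ^ s < N * card {\<sigma>. \<sigma> < 2 ^ s \<and> caught p (j m) s \<sigma> c}" for m s c
    have "\<exists>m. \<forall>s. \<not> R m s (cell z s)"
    proof (rule martin_loef_random_cells[OF z])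
      show "recfun empty_oracle 3 (\<lambda>xs. of_bool (R (xs ! 0) (xs ! 1) (xs ! 2)))"
        unfolding R_def j_def
        by (intro recfun_less recfun_mult recfun_power2 recfun_card recfun_caught D recfun_intros) simp_all
      show "R m (Suc s) c" if "R m s (c div 2)" for m s c
      proof -
        let ?X = "{\<sigma>. \<sigma> < 2 ^ s \<and> caught p (j m) s \<sigma> (c div 2)}"
        have shift: "(\<sigma> + 2 ^ s) div 2 ^ x mod 2 = \<sigma> div 2 ^ x mod 2" if "x < s" for \<sigma> x :: nat
        proof -
          obtain d where d: "s = x + Suc d" using less_imp_Suc_add[OF \<open>x < s\<close>] by auto
          have "\<sigma> + 2 ^ s = \<sigma> + 2 ^ Suc d * 2 ^ x" by (simp add: d power_add)
          then have "(\<sigma> + 2 ^ s) div 2 ^ x = 2 ^ Suc d + \<sigma> div 2 ^ x"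
            by (simp only: div_mult_self1 power_not_zero zero_neq_numeral[symmetric] not_False_eq_True)
          then show ?thesis by simp
        qed
        \<comment> \<open>Adding \<open>2 ^ s\<close> sets the next oracle bit. Both one-bit
          extensions of a catching prefix still catch the subcell, so the fraction of catching
          prefixes does not fall.\<close>
        have "?X \<union> (\<lambda>\<sigma>. \<sigma> + 2 ^ s) ` ?X \<subseteq> {\<sigma>. \<sigma> < 2 ^ Suc s \<and> caught p (j m) (Suc s) \<sigma> c}"
          by (auto intro: caught_mono shift)
        then have "card (?X \<union> (\<lambda>\<sigma>. \<sigma> + 2 ^ s) ` ?X) \<le> card {\<sigma>. \<sigma> < 2 ^ Suc s \<and> caught p (j m) (Suc s) \<sigma> c}"
          by (intro card_mono) auto
        moreover have "card (?X \<union> (\<lambda>\<sigma>. \<sigma> + 2 ^ s) ` ?X) = card ?X + card ?X"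
          by (subst card_Un_disjoint) (auto simp: card_image)
        ultimately have "N * (card ?X + card ?X) \<le> N * card {\<sigma>. \<sigma> < 2 ^ Suc s \<and> caught p (j m) (Suc s) \<sigma> c}"
          by simp
        then show ?thesis using that unfolding R_def by (simp add: add_mult_distrib2)
      qed
      show "real (card {c. c < 2 ^ s \<and> R m s c}) \<le> 2 ^ s / 2 ^ m" for m s
      proof -
        let ?C = "{..<2 ^ s :: nat}"
        have sum_card: "(\<Sum>i\<in>?C. of_bool (P i)) = real (card {i. i < 2 ^ s \<and> P i})" for P
          by (simp add: sum.If_cases of_bool_def lessThan_def Collect_conj_eq)
        have "2 ^ s * real (card {c. c < 2 ^ s \<and> R m s c}) = (\<Sum>c\<in>?C. 2 ^ s * of_bool (R m s c))"
          unfolding sum_distrib_left[symmetric] sum_card ..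
        also have "\<dots> \<le> (\<Sum>c\<in>?C. N * real (card {\<sigma>. \<sigma> < 2 ^ s \<and> caught p (j m) s \<sigma> c}))"
        proof (rule sum_mono)
          fix c
          show "2 ^ s * of_bool (R m s c) \<le> N * real (card {\<sigma>. \<sigma> < 2 ^ s \<and> caught p (j m) s \<sigma> c})"
          proof (cases "R m s c")
            case True
            then have "real (2 ^ s) \<le> real (N * card {\<sigma>. \<sigma> < 2 ^ s \<and> caught p (j m) s \<sigma> c})"
              unfolding R_def by (intro of_nat_mono) simp
            then show ?thesis using True by simp
          qed simp
        qed
        \<comment> \<open>The order of summation is exchanged, so that the inner count is over cells
          for a fixed prefix and the supermartingale bound applies.\<close>
        also have "\<dots> = N * (\<Sum>\<sigma>\<in>?C. real (card {c. c < 2 ^ s \<and> caught p (j m) s \<sigma> c}))"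
          unfolding sum_card[symmetric] sum_distrib_left[symmetric] by (subst sum.swap) simp
        also have "\<dots> \<le> N * (\<Sum>\<sigma>\<in>?C. ratio ^ j m * 2 ^ s)"
          by (intro mult_left_mono sum_mono card_caught_le) auto
        also have "\<dots> = 2 ^ s * (2 ^ s * (N * ratio ^ j m))" by simp
        finally have "real (card {c. c < 2 ^ s \<and> R m s c}) \<le> 2 ^ s * (N * ratio ^ j m)"
          by (simp only: mult_le_cancel_left_pos zero_less_power zero_less_numeral)
        also have "N * ratio ^ j m \<le> 1 / 2 ^ m"
        proof -
          have "ratio ^ j m \<le> (1 / 2) ^ (m + N)"
            unfolding j_def power_mult using J ratio by (intro power_mono) auto
          moreover have "real N \<le> 2 ^ N" by (metis less_exp less_imp_le of_nat_le_iff of_nat_numeral of_nat_power)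
          ultimately have "N * ratio ^ j m \<le> 2 ^ N * (1 / 2) ^ (m + N)"
            using ratio by (intro mult_mono) auto
          also have "\<dots> = 1 / 2 ^ m" by (simp add: power_add power_one_over)
          finally show ?thesis .
        qed
        then have "2 ^ s * (N * ratio ^ j m) \<le> 2 ^ s * (1 / 2 ^ m)" by (intro mult_left_mono) auto
        finally show ?thesis by simp
      qed
    qed
    then obtain m where m: "\<And>s. \<not> R m s (cell z s)" by blast
    define E where "E s = {A. caught p (j m) s (prefix_code A s) (cell z s)}" for s
    have E_sets: "E s \<in> sets cantor_measure" for s
      unfolding E_def by (rule cantor_prefix_code)
    have "emeasure cantor_measure (E s) \<le> ennreal (1 / N)" for s
    proof -
      have "measure cantor_measure (E s) = card {\<sigma>. \<sigma> < 2 ^ s \<and> caught p (j m) s \<sigma> (cell z s)} / 2 ^ s"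
        unfolding E_def by (rule cantor_prefix_code)
      moreover have "real (N * card {\<sigma>. \<sigma> < 2 ^ s \<and> caught p (j m) s \<sigma> (cell z s)}) \<le> real (2 ^ s)"
        using m[of s] unfolding R_def by (intro of_nat_mono) simp
      then have "card {\<sigma>. \<sigma> < 2 ^ s \<and> caught p (j m) s \<sigma> (cell z s)} / 2 ^ s \<le> 1 / real N"
        using \<open>0 < N\<close> by (simp add: field_simps)
      ultimately have "measure cantor_measure (E s) \<le> 1 / N" by simp
      then show ?thesis unfolding emeasure_eq_measure by (rule ennreal_leI)
    qed
    then have "(SUP s. emeasure cantor_measure (E s)) \<le> ennreal (1 / N)" by (rule SUP_least)
    moreover have "incseq E"
    proof (rule incseq_SucI, rule subsetI)
      fix s A assume "A \<in> E s"
      moreover have "cell z (Suc s) div 2 = cell z s" using cell_div[OF z01, of s "Suc s"] by simp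
      ultimately show "A \<in> E (Suc s)"
        unfolding E_def by (auto intro!: caught_mono[where \<sigma> = "prefix_code A s"] prefix_code_bit_mono)
    qed
    then have "(SUP s. emeasure cantor_measure (E s)) = emeasure cantor_measure (\<Union>s. E s)"
      using E_sets by (intro SUP_emeasure_incseq) auto
    moreover have "bad \<subseteq> (\<Union>s. E s)"
    proof
      fix A assume "A \<in> bad"
      define n where "n = j m"
      from \<open>A \<in> bad\<close> obtain h where h: "\<And>n. computes A p [n] (h n)"
        and inf: "infinite {k. drop_at (\<Sum>n<Suc (2 * k). Suc (h n)) (\<Sum>n<Suc (2 * Suc k). Suc (h n))
          (cell z (\<Sum>n<Suc (2 * Suc k). Suc (h n)))}"
        unfolding bad_def by blast
      define T where "T k = (\<Sum>n<Suc (2 * k). Suc (h n))" for k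
      obtain B where B: "finite B" "card B = n" "B \<subseteq> {k. drop_at (T k) (T (Suc k)) (cell z (T (Suc k)))}"
        using infinite_arbitrarily_large[OF inf, of n] unfolding T_def by blast
      obtain k where k: "\<And>i. i \<in> B \<Longrightarrow> i < k"
        using B(1) finite_nat_set_iff_bounded by auto
      obtain s0 where s0: "\<And>i s. s0 i \<le> s \<Longrightarrow> beval p (prefix_code A s) s [i] = Suc (h i)"
        using computes_imp_beval[OF h] by metis
      \<comment> \<open>Large enough for the last stage \<open>T k\<close>, for the index
        \<open>k\<close>, and for \<open>p\<close> to halt on all inputs up to \<open>2 * k\<close>
        with \<open>s\<close> bits of the oracle.\<close>
      define s where "s = T k + k + (\<Sum>i<Suc (2 * k). s0 i)"
      have ev: "beval p (prefix_code A s) s [i] = Suc (h i)" if "i < Suc (2 * k)" for i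
      proof (rule s0)
        have "s0 i \<le> (\<Sum>i<Suc (2 * k). s0 i)" using that by (intro member_le_sum) auto
        then show "s0 i \<le> s" by (simp add: s_def)
      qed
      have s: "k < Suc s" "T k \<le> s" by (simp_all add: s_def)
      have stage: "stage p (prefix_code A s) s i = T i" if "i \<le> k" for i
        unfolding stage_def T_def by (intro sum.cong ev) (use that in auto)
      have Tk: "T i \<le> T k" if "i \<le> k" for i
        unfolding T_def using that by (intro sum_mono2) auto
      have cell: "cell z s div 2 ^ (s - T i) = cell z (T i)" if "i \<le> k" for i
        using Tk[OF that] by (intro cell_div z01) (simp add: s_def)
      have "n \<le> drops (stage p (prefix_code A s) s) k s (cell z s)"
      proof -
        have "B \<subseteq> {i. i < k \<and> drop_at (stage p (prefix_code A s) s i) (stage p (prefix_code A s) s (Suc i))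
           (cell z s div 2 ^ (s - stage p (prefix_code A s) s (Suc i)))}"
          using B(3) k by (auto simp: stage cell Suc_le_eq less_imp_le)
        then show ?thesis unfolding drops_def B(2)[symmetric] by (intro card_mono) auto
      qed
      then have "caught p n s (prefix_code A s) (cell z s)"
        unfolding caught_def using alive[of "T k"] ev s
        by (intro exI[of _ k]) (auto simp: stage cell defined_upto_def)
      then show "A \<in> (\<Union>s. E s)" unfolding E_def n_def by blast
    qed
    ultimately show ?thesis using E_sets by (intro exI[of _ "\<Union>s. E s"]) auto
  qed
  obtain E where E: "\<And>N. E N \<in> sets cantor_measure" "\<And>N. bad \<subseteq> E N"
    "\<And>N. emeasure cantor_measure (E N) \<le> ennreal (1 / Suc N)"
    using cover[of "Suc _"] by (metis zero_less_Suc)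
  have small: "emeasure cantor_measure (\<Inter>N. E N) \<le> ennreal e" if "0 < e" for e
  proof -
    obtain N where "1 / real (Suc N) < e" using nat_approx_posE[OF \<open>0 < e\<close>] by auto
    moreover have "emeasure cantor_measure (\<Inter>N. E N) \<le> emeasure cantor_measure (E N)"
      by (intro emeasure_mono) (auto simp: E)
    ultimately show ?thesis using E(3)[of N] by (meson ennreal_leI less_imp_le order_trans)
  qed
  have "emeasure cantor_measure (\<Inter>N. E N) \<le> 0"
  proof (rule ennreal_le_epsilon)
    fix e :: real assume "0 < e"
    then show "emeasure cantor_measure (\<Inter>N. E N) \<le> 0 + ennreal e" using small by simp
  qed
  then have null: "(\<Inter>N. E N) \<in> null_sets cantor_measure"
    using E(1) by (auto simp: null_sets_def)
  have sub: "bad \<subseteq> (\<Inter>N. E N)" using E(2) by blast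
  show ?thesis
    by (rule AE_I'[OF null], rule order_trans[OF _ sub]) (unfold bad_def, blast)
qed

end

subsection \<open>The dominating function\<close>

lemma cell_Suc: "0 \<le> x \<Longrightarrow> cell x (Suc s) = 2 * cell x s + of_bool (odd (cell x (Suc s)))"
proof -
  assume "0 \<le> x"
  then have "cell x (Suc s) div 2 = cell x s" using cell_div[of x s "Suc s"] by simp
  moreover have "cell x (Suc s) = 2 * (cell x (Suc s) div 2) + of_bool (odd (cell x (Suc s)))"
    by (simp add: of_bool_odd_eq_mod_2)
  ultimately show ?thesis by simp
qed

lemma cell_0: "0 \<le> x \<Longrightarrow> x < 1 \<Longrightarrow> cell x 0 = 0"
  using cell_less[of x 0] by simp

definition digits :: "real \<Rightarrow> nat \<Rightarrow> bool" where
  "digits z n \<longleftrightarrow> odd (cell z (Suc n))"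

lemma binary_expansion_digits:
  assumes "0 \<le> z" "z < 1"
  shows "binary_expansion (digits z) z"
proof -
  have eq: "(\<Sum>i<n. of_bool (digits z i) * (1 / 2) ^ Suc i) = real (cell z n) / 2 ^ n" for n
  proof (induction n)
    case 0
    then show ?case using assms by (simp add: cell_0)
  next
    case (Suc n)
    have "real (cell z (Suc n)) = 2 * real (cell z n) + of_bool (digits z n)"
      unfolding digits_def using arg_cong[OF cell_Suc[OF assms(1), of n], of real] by simp
    then show ?case using Suc by (simp add: field_simps power_one_over)
  qed
  have "(\<lambda>n. real (cell z n) / 2 ^ n) \<longlonglongrightarrow> z"
  proof (rule tendsto_sandwich)
    have "z \<le> (real (cell z n) + 1) / 2 ^ n" for n
      using cell_bounds(2)[OF assms(1), of n] by (simp add: field_simps)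
    then have "z - (1 / 2) ^ n \<le> real (cell z n) / 2 ^ n" for n
      by (simp add: add_divide_distrib power_one_over algebra_simps)
    then show "\<forall>\<^sub>F n in sequentially. z - (1 / 2) ^ n \<le> real (cell z n) / 2 ^ n" by simp
    show "\<forall>\<^sub>F n in sequentially. real (cell z n) / 2 ^ n \<le> z"
      using cell_bounds(1)[OF assms(1)] by (intro always_eventually allI) (simp add: field_simps)
    have "(\<lambda>n. z - (1 / 2) ^ n) \<longlonglongrightarrow> z - 0"
      by (intro tendsto_intros LIMSEQ_realpow_zero) auto
    then show "(\<lambda>n. z - (1 / 2) ^ n) \<longlonglongrightarrow> z" by simp
  qed simp
  then show ?thesis unfolding binary_expansion_def sums_def eq .
qed

lemma recfun_cell:
  assumes "0 \<le> z" "z < 1" "recfun (digits z) k F"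
  shows "recfun (digits z) k (\<lambda>xs. cell z (F xs))"
proof (rule recfun_comp1[OF _ assms(3)])
  have eq: "rec_nat 0 (\<lambda>n r. 2 * r + of_bool (digits z n)) n = cell z n" for n
  proof (induction n)
    case 0
    then show ?case using assms by (simp add: cell_0)
  next
    case (Suc n)
    then show ?case using cell_Suc[OF assms(1), of n] by (simp add: digits_def)
  qed
  have "recfun (digits z) 1 (\<lambda>xs. rec_nat 0 (\<lambda>n r. 2 * r + of_bool (digits z n)) (xs ! 0))"
    by (intro recfun_rec_nat recfun_add recfun_mult recfun_oracle recfun_intros) auto
  then show "recfun (digits z) 1 (\<lambda>xs. cell z (xs ! 0))" unfolding eq .
qed

context dead_cells
begin

definition drop_stage :: "real \<Rightarrow> nat \<Rightarrow> nat" where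
  "drop_stage z = rec_nat 0 (\<lambda>_ r. LEAST s. r < s \<and> drop_at r s (cell z s))"

lemma drop_stage_Suc:
  assumes "\<And>t. \<exists>s>t. drop_at t s (cell z s)"
  shows "drop_stage z n < drop_stage z (Suc n)"
    and "drop_at (drop_stage z n) (drop_stage z (Suc n)) (cell z (drop_stage z (Suc n)))"
proof -
  let ?P = "\<lambda>s. drop_stage z n < s \<and> drop_at (drop_stage z n) s (cell z s)"
  obtain s where "?P s" using assms by blast
  then have "?P (Least ?P)" by (rule LeastI)
  moreover have "drop_stage z (Suc n) = Least ?P" by (simp add: drop_stage_def)
  ultimately show "drop_stage z n < drop_stage z (Suc n)"
    and "drop_at (drop_stage z n) (drop_stage z (Suc n)) (cell z (drop_stage z (Suc n)))" by simp_all
qed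

text \<open>The search in each recursion step halts because drops recur beyond every level, and what
  it needs to know about \<open>z\<close> are the cells, which are read off the digits.\<close>

lemma real_computes_drop_stage:
  assumes z: "0 \<le> z" "z < 1" and D: "recfun (digits z) 2 (\<lambda>xs. of_bool (dead (xs ! 0) (xs ! 1)))"
    and drop: "\<And>t. \<exists>s>t. drop_at t s (cell z s)"
  shows "real_computes z (drop_stage z)"
proof -
  define P where "P s xs \<longleftrightarrow> xs ! 1 < s \<and> drop_at (xs ! 1) s (cell z s)" for s and xs :: "nat list"
  have "recfun (digits z) (Suc 2) (\<lambda>ys. of_bool (P (ys ! 0) (tl ys)))"
    unfolding P_def by (intro recfun_conj recfun_less recfun_drop_at D recfun_cell z recfun_intros) simp_all
  then obtain e where e: "\<And>xs w. length xs = 2 \<Longrightarrow> P w xs \<Longrightarrow> computes (digits z) e xs (LEAST w. P w xs)"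
    by (rule recfun_search) blast
  have "computes (digits z) (Prec Zero e) [n] (drop_stage z n)" for n
  proof (induction n)
    case 0
    show ?case by (auto simp: drop_stage_def intro: computes.intros)
  next
    case (Suc n)
    obtain s where "drop_stage z n < s \<and> drop_at (drop_stage z n) s (cell z s)" using drop by blast
    then have "computes (digits z) e [n, drop_stage z n] (drop_stage z (Suc n))"
      using e[of "[n, drop_stage z n]" s] by (simp add: P_def drop_stage_def)
    with Suc show ?case by (rule computes.Prec_Suc)
  qed
  then show ?thesis
    unfolding real_computes_def computable_in_def using binary_expansion_digits[OF z] by blast
qed

text \<open>For large \<open>k\<close> each interval \<open>[T k, T (k + 1)]\<close> contains at most one value of
  \<open>drop_stage\<close>, which then grows at least as fast as \<open>T\<close> up to an index shift; the factor 2 in \<open>T\<close> absorbs the shift.\<close>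
lemma dominates_drop_stage:
  fixes h :: "nat \<Rightarrow> nat"
  defines "T \<equiv> \<lambda>k. \<Sum>n<Suc (2 * k). Suc (h n)"
  assumes z: "0 \<le> z" and drop: "\<And>t. \<exists>s>t. drop_at t s (cell z s)"
    and fin: "finite {k. drop_at (T k) (T (Suc k)) (cell z (T (Suc k)))}"
  shows "dominates (drop_stage z) h"
proof -
  let ?f = "drop_stage z"
  note f = drop_stage_Suc[OF drop]
  obtain k0 where k0: "\<And>k. k0 \<le> k \<Longrightarrow> \<not> drop_at (T k) (T (Suc k)) (cell z (T (Suc k)))"
    using fin unfolding finite_nat_set_iff_bounded by (meson mem_Collect_eq not_le)
  have "n \<le> ?f n" for n
  proof (induction n)
    case (Suc n)
    then show ?case using f(1)[of n] by simp
  qed simp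
  then obtain m0 where m0: "T k0 \<le> ?f m0" by blast
  have ge: "T (k0 + j) \<le> ?f (m0 + j)" for j
  proof (induction j)
    case (Suc j)
    show ?case
    proof (rule ccontr)
      let ?t = "?f (m0 + j)" and ?s = "?f (Suc (m0 + j))" and ?u = "T (Suc (k0 + j))"
      \<comment> \<open>Otherwise two consecutive values of \<open>drop_stage\<close> lie between
        \<open>T (k0 + j)\<close> and \<open>T (Suc (k0 + j))\<close>, and widening the drop between
        them contradicts the choice of \<open>k0\<close>.\<close>
      assume "\<not> ?thesis"
      then have le: "?s \<le> ?u" by simp
      have "drop_at ?t ?s (cell z ?u div 2 ^ (?u - ?s))"
        using f(2)[of "m0 + j"] cell_div[OF z le] by simp
      then have "drop_at (T (k0 + j)) ?u (cell z ?u)"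
        by (rule drop_at_mono) (use Suc le f(1)[of "m0 + j"] in auto)
      then show False using k0[of "k0 + j"] by simp
    qed
  qed (simp add: m0)
  have "h n \<le> ?f n" if "2 * m0 \<le> n" for n
  proof -
    \<comment> \<open>From \<open>2 * m0 \<le> n\<close> follows
      \<open>n \<le> 2 * (n - m0)\<close>, so \<open>h n\<close> occurs among the summands of
      \<open>T (k0 + j)\<close>.\<close>
    define j where "j = n - m0"
    have n: "n = m0 + j" "n \<le> 2 * (k0 + j)" using that by (auto simp: j_def)
    have "h n \<le> Suc (h n)" by simp
    also have "\<dots> \<le> T (k0 + j)"
      unfolding T_def using n(2) by (intro member_le_sum[where f = "\<lambda>n. Suc (h n)"]) auto
    also have "\<dots> \<le> ?f n" using ge[of j] n(1) by simp
    finally show ?thesis .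
  qed
  then show ?thesis unfolding dominates_def eventually_sequentially by blast
qed

end

instance prog :: countable by countable_datatype

lemma (in dead_cells) uniformly_ae_dominating_if_drops:
  assumes "martin_loef_random z" "z \<in> {0..1}"
    and D: "\<And>A. recfun A 2 (\<lambda>xs. of_bool (dead (xs ! 0) (xs ! 1)))"
    and alive: "\<And>s. \<not> dead s (cell z s)"
    and drop: "\<And>t. \<exists>s>t. drop_at t s (cell z s)"
  shows "uniformly_ae_dominating z"
proof -
  have z: "0 \<le> z" "z < 1"
    using assms(2) martin_loef_random_not_dyadic[OF assms(1,2), of 1 0] by auto
  \<comment> \<open>There are countably many programs, so their exceptional null sets can be
    united.\<close>
  have "AE A in cantor_measure. \<forall>p h. (\<forall>n. computes A p [n] (h n)) \<longrightarrow>
    finite {k. drop_at (\<Sum>n<Suc (2 * k). Suc (h n)) (\<Sum>n<Suc (2 * Suc k). Suc (h n))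
        (cell z (\<Sum>n<Suc (2 * Suc k). Suc (h n)))}"
    unfolding AE_all_countable using AE_program[OF assms(1,2) D alive] by blast
  then have "AE A in cantor_measure. \<forall>h. computable_in A h \<longrightarrow> dominates (drop_stage z) h"
  proof (rule AE_mp, intro AE_I2 impI allI)
    fix A h
    assume *: "\<forall>p h. (\<forall>n. computes A p [n] (h n)) \<longrightarrow>
      finite {k. drop_at (\<Sum>n<Suc (2 * k). Suc (h n)) (\<Sum>n<Suc (2 * Suc k). Suc (h n))
          (cell z (\<Sum>n<Suc (2 * Suc k). Suc (h n)))}"
      and "computable_in A h"
    then obtain p where "\<forall>n. computes A p [n] (h n)" unfolding computable_in_def by blast
    with * show "dominates (drop_stage z) h" by (intro dominates_drop_stage z drop) blast
  qed
  then show ?thesis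
    unfolding uniformly_ae_dominating_def using real_computes_drop_stage[OF z D drop] by blast
qed

subsection \<open>Effectively closed classes and density\<close>

lemma int_decode_eq: "int_decode p = (if even p then int (p div 2) else - int (p div 2) - 1)"
  by (simp add: int_decode_def sum_decode_def)

lemma prod_encode_less: "p < Suc (prod_encode (p, q))" "q < Suc (prod_encode (p, q))"
  by (simp_all add: less_Suc_eq_le le_prod_encode_1 le_prod_encode_2)

text \<open>The right side is bounded arithmetic on natural numbers, hence recursive: the pair is
  searched for below its code, an odd \<open>p\<close> codes a negative numerator, an even one the
  numerator \<open>p div 2\<close>, and fractions are cross-multiplied.\<close>

lemma rat_code_less_iff:
  "rat_code i < real c / 2 ^ s \<longleftrightarrow>
    (\<exists>p<Suc i. \<exists>q<Suc i. prod_encode (p, q) = i \<and> (p mod 2 = 1 \<or> p div 2 * 2 ^ s < c * Suc q))"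
proof -
  obtain p q where i: "i = prod_encode (p, q)" by (metis prod_decode_inverse surj_pair)
  have "rat_code i < real c / 2 ^ s \<longleftrightarrow> p mod 2 = 1 \<or> p div 2 * 2 ^ s < c * Suc q"
  proof (cases "even p")
    case True
    have "rat_code i < real c / 2 ^ s \<longleftrightarrow> real (p div 2 * 2 ^ s) < real (c * Suc q)"
      using True by (simp add: i rat_code_def int_decode_eq field_simps)
    then show ?thesis using True by (simp only: of_nat_less_iff) auto
  next
    case False
    have "rat_code i < 0" using False by (simp add: i rat_code_def int_decode_eq divide_less_0_iff)
    also have "0 \<le> real c / 2 ^ s" by simp
    finally show ?thesis using False by (simp add: odd_iff_mod_2_eq_one)
  qed
  then show ?thesis using prod_encode_less unfolding i by (auto simp: prod_encode_eq)
qed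

lemma less_rat_code_iff:
  "real c / 2 ^ s < rat_code i \<longleftrightarrow>
    (\<exists>p<Suc i. \<exists>q<Suc i. prod_encode (p, q) = i \<and> (p mod 2 = 0 \<and> c * Suc q < p div 2 * 2 ^ s))"
proof -
  obtain p q where i: "i = prod_encode (p, q)" by (metis prod_decode_inverse surj_pair)
  have "real c / 2 ^ s < rat_code i \<longleftrightarrow> p mod 2 = 0 \<and> c * Suc q < p div 2 * 2 ^ s"
  proof (cases "even p")
    case True
    have "real c / 2 ^ s < rat_code i \<longleftrightarrow> real (c * Suc q) < real (p div 2 * 2 ^ s)"
      using True by (simp add: i rat_code_def int_decode_eq field_simps)
    then show ?thesis using True by (simp only: of_nat_less_iff) auto
  next
    case False
    have "rat_code i < 0" using False by (simp add: i rat_code_def int_decode_eq divide_less_0_iff)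
    moreover have "0 \<le> real c / 2 ^ s" by simp
    ultimately have "\<not> real c / 2 ^ s < rat_code i" by linarith
    then show ?thesis using False by (simp add: odd_iff_mod_2_eq_one)
  qed
  then show ?thesis using prod_encode_less unfolding i by (auto simp: prod_encode_eq)
qed

text \<open>Death requires the closed cell to fit inside a single one of the first \<open>s\<close>
  intervals. A cell covered only by several of them together is missed, but every point of the open
  complement eventually lies in a dead cell, so the measure is exhausted in the limit.\<close>

definition dead_cell :: "(nat \<Rightarrow> nat) \<Rightarrow> (nat \<Rightarrow> nat) \<Rightarrow> nat \<Rightarrow> nat \<Rightarrow> bool" where
  "dead_cell a b s c \<longleftrightarrow> (\<exists>k<s. rat_code (a k) < real c / 2 ^ s \<and> real (Suc c) / 2 ^ s < rat_code (b k))"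

lemma recfun_dead_cell:
  assumes "computable a" "computable b"
  shows "recfun A 2 (\<lambda>xs. of_bool (dead_cell a b (xs ! 0) (xs ! 1)))"
  unfolding dead_cell_def rat_code_less_iff less_rat_code_iff
  by (intro recfun_ex recfun_conj recfun_disj recfun_eq recfun_less recfun_mult recfun_prod_encode
      computable_imp_recfun[OF assms(1)] computable_imp_recfun[OF assms(2)] recfun_intros) simp_all

lemma dead_cells_dead_cell: "dead_cells (dead_cell a b)"
proof
  fix s c
  assume "dead_cell a b s (c div 2)"
  then obtain k where k: "k < s" "rat_code (a k) < real (c div 2) / 2 ^ s"
    "real (Suc (c div 2)) / 2 ^ s < rat_code (b k)" by (auto simp: dead_cell_def)
  have "real (2 * (c div 2)) \<le> real c" "real (Suc c) \<le> real (2 * Suc (c div 2))"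
    by (simp_all only: of_nat_le_iff) auto
  then have "real (c div 2) \<le> real c / 2" "real (Suc c) / 2 \<le> real (Suc (c div 2))" by simp_all
  from this[THEN divide_right_mono, of "2 ^ s"]
  have "real (c div 2) / 2 ^ s \<le> real c / 2 ^ Suc s" "real (Suc c) / 2 ^ Suc s \<le> real (Suc (c div 2)) / 2 ^ s"
    by (simp_all add: divide_divide_eq_left)
  with k show "dead_cell a b (Suc s) c" unfolding dead_cell_def by (intro exI[of _ k]) auto
qed

text \<open>The quotients never exceed 1, so a lower density other than 1 lies below some
  \<open>1 - \<epsilon>\<close>.\<close>

lemma lower_density_neq_1:
  assumes "lower_density C z \<noteq> 1"
  shows "\<exists>\<epsilon>>0. \<forall>\<eta>>0. \<exists>\<gamma> \<delta>. 0 < \<gamma> \<and> \<gamma> < \<eta> \<and> 0 < \<delta> \<and> \<delta> < \<eta> \<and>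
    measure lborel ({z - \<gamma>..z + \<delta>} \<inter> C) < (1 - \<epsilon>) * (\<gamma> + \<delta>)"
proof (rule ccontr)
  let ?F = "at_right (0::real) \<times>\<^sub>F at_right (0::real)"
  let ?m = "\<lambda>\<gamma> \<delta>. measure lborel ({z - \<gamma>..z + \<delta>} \<inter> C)"
  let ?r = "\<lambda>(\<gamma>, \<delta>). ereal (?m \<gamma> \<delta> / (\<gamma> + \<delta>))"
  assume contra: "\<not> ?thesis"
  have ev: "eventually P ?F" if "0 < \<eta>"
    and P: "\<And>\<gamma> \<delta>. 0 < \<gamma> \<Longrightarrow> \<gamma> < \<eta> \<Longrightarrow> 0 < \<delta> \<Longrightarrow> \<delta> < \<eta> \<Longrightarrow> P (\<gamma>, \<delta>)" for \<eta> P
  proof -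
    have "eventually (\<lambda>\<gamma>. \<gamma> \<in> {0<..<\<eta>}) (at_right 0)" using \<open>0 < \<eta>\<close> by (rule eventually_at_right_real)
    from eventually_prodI[OF this this] show ?thesis
      by (rule eventually_mono) (use P in auto)
  qed
  have le: "ereal (1 - \<epsilon>) \<le> lower_density C z" if "0 < \<epsilon>" for \<epsilon>
  proof -
    obtain \<eta> where \<eta>: "0 < \<eta>" "\<And>\<gamma> \<delta>. 0 < \<gamma> \<Longrightarrow> \<gamma> < \<eta> \<Longrightarrow> 0 < \<delta> \<Longrightarrow> \<delta> < \<eta> \<Longrightarrow> (1 - \<epsilon>) * (\<gamma> + \<delta>) \<le> ?m \<gamma> \<delta>"
      using contra \<open>0 < \<epsilon>\<close> by (meson not_less)
    show ?thesis
      unfolding lower_density_def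
      by (intro Liminf_bounded ev[OF \<eta>(1)]) (use \<eta>(2) in \<open>simp add: field_simps\<close>)
  qed
  have "lower_density C z \<le> 1"
  proof -
    have "?F \<noteq> bot" by (simp add: prod_filter_eq_bot trivial_limit_at_right_real)
    then have "lower_density C z \<le> Limsup ?F ?r" unfolding lower_density_def by (rule Liminf_le_Limsup)
    also have "\<dots> \<le> 1"
    proof (rule Limsup_bounded, rule ev[of 1])
      fix \<gamma> \<delta> :: real assume "0 < \<gamma>" "0 < \<delta>"
      have "?m \<gamma> \<delta> \<le> \<gamma> + \<delta>"
      \<comment> \<open>No measurability of \<open>C\<close> is assumed; outside the sigma-algebra
        \<open>measure\<close> is 0 by convention.\<close>
      proof (cases "{z - \<gamma>..z + \<delta>} \<inter> C \<in> sets lborel")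
        case True
        then have "?m \<gamma> \<delta> \<le> measure lborel {z - \<gamma>..z + \<delta>}"
          by (intro measure_mono_fmeasurable) (auto simp: fmeasurable_def emeasure_lborel_Icc_eq)
        then show ?thesis using \<open>0 < \<gamma>\<close> \<open>0 < \<delta>\<close> by simp
      qed (use \<open>0 < \<gamma>\<close> \<open>0 < \<delta>\<close> in \<open>simp add: measure_notin_sets\<close>)
      then show "?r (\<gamma>, \<delta>) \<le> 1" using \<open>0 < \<gamma>\<close> \<open>0 < \<delta>\<close> by (simp add: field_simps)
    qed simp
    finally show ?thesis .
  qed
  with assms have "lower_density C z < 1" by simp
  then obtain r where r: "lower_density C z < ereal r" "ereal r < 1" using ereal_dense2 by blast
  from le[of "1 - r"] r show False by (simp add: not_le[symmetric] one_ereal_def)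
qed

lemma cell_mono: "x \<le> y \<Longrightarrow> cell x s \<le> cell y s"
  unfolding cell_def by (intro nat_mono floor_mono mult_right_mono) auto

text \<open>As \<open>z\<close> is not dyadic, it is interior to its cell of level \<open>t\<close>,
  so an interval around it that loses more than the fraction \<open>\<epsilon>\<close> fits inside.
  The dead cells increase to cover this loss, hence at some level they already exceed the fraction
  \<open>\<epsilon>\<close> of the interval. Rounding the interval outwards to the grid at most
  doubles its length, whence \<open>2 / \<epsilon> \<le> K\<close>.\<close>

lemma drop_if_not_density_one:
  assumes C: "{0..1} - C = {0..1} \<inter> (\<Union>k. rat_interval (a k) (b k))" "C \<subseteq> {0..1}"
    and z: "0 \<le> z" "z < 1" "\<And>x n. z \<noteq> real x / 2 ^ n"
    and \<epsilon>: "0 < \<epsilon>" "\<And>\<eta>. 0 < \<eta> \<Longrightarrow> \<exists>\<gamma> \<delta>. 0 < \<gamma> \<and> \<gamma> < \<eta> \<and> 0 < \<delta> \<and> \<delta> < \<eta> \<and>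
      measure lborel ({z - \<gamma>..z + \<delta>} \<inter> C) < (1 - \<epsilon>) * (\<gamma> + \<delta>)"
    and K: "2 / \<epsilon> \<le> real K"
  shows "\<exists>s>t. dead_cells.drop_at (dead_cell a b) K t s (cell z s)"
proof -
  interpret dead_cells "dead_cell a b" K by (rule dead_cells_dead_cell)
  let ?O = "\<Union>k. rat_interval (a k) (b k)"
  define c where "c = cell z t"
  have zc: "real c / 2 ^ t < z" "z < (real c + 1) / 2 ^ t"
    using cell_bounds[OF z(1), of t] z(3)[of c t] unfolding c_def by (auto simp: field_simps)
  have c1: "(real c + 1) / 2 ^ t \<le> 1"
    using cell_less[OF z(1,2), of t] unfolding c_def
    by (simp add: Suc_le_eq[symmetric] del: of_nat_Suc)
       (metis Suc_eq_plus1 Suc_leI of_nat_1 of_nat_add of_nat_le_iff of_nat_numeral of_nat_power)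
  obtain \<gamma> \<delta> where gd: "0 < \<gamma>" "0 < \<delta>" "\<gamma> < z - real c / 2 ^ t" "\<delta> < (real c + 1) / 2 ^ t - z"
    and small: "measure lborel ({z - \<gamma>..z + \<delta>} \<inter> C) < (1 - \<epsilon>) * (\<gamma> + \<delta>)"
    using \<epsilon>(2)[of "min (z - real c / 2 ^ t) ((real c + 1) / 2 ^ t - z)"] zc by auto
  let ?J = "{z - \<gamma>..z + \<delta>}" and ?l = "\<gamma> + \<delta>"
  have in_cell: "real c / 2 ^ t < x" "x < (real c + 1) / 2 ^ t" "0 < x" "x < 1" if "x \<in> ?J" for x
  proof -
    show 1: "real c / 2 ^ t < x" "x < (real c + 1) / 2 ^ t" using that gd by auto
    have "0 \<le> real c / 2 ^ t" by simp
    with 1 c1 show "0 < x" "x < 1" by linarith+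
  qed
  have cell_J: "cell x t = c" if "x \<in> ?J" for x
    using in_cell(1,2)[OF that] by (intro cell_eqI) (auto simp: field_simps)
  have J01: "?J \<subseteq> {0..1}" using in_cell(3,4) by (meson atLeastAtMost_iff less_imp_le subsetI)
  have O_sets: "?J \<inter> ?O \<in> sets lborel" by (auto simp: rat_interval_def)
  have JC: "?J \<inter> C = ?J - ?J \<inter> ?O" using C J01 by blast
  have "measure lborel (?J \<inter> C) = measure lborel ?J - measure lborel (?J \<inter> ?O)"
    unfolding JC by (intro measure_Diff) (use O_sets in \<open>auto simp: emeasure_lborel_Icc_eq\<close>)
  then have pos: "0 < \<epsilon> * ?l" and "\<epsilon> * ?l < measure lborel (?J \<inter> ?O)" using small gd \<epsilon>(1) by (simp_all add: algebra_simps add_pos_pos)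
  moreover have "emeasure lborel (?J \<inter> ?O) = ennreal (measure lborel (?J \<inter> ?O))"
  proof (rule emeasure_eq_ennreal_measure)
    have "emeasure lborel (?J \<inter> ?O) \<le> emeasure lborel ?J" by (intro emeasure_mono) auto
    then show "emeasure lborel (?J \<inter> ?O) \<noteq> top" using gd by (auto simp: top_unique)
  qed
  ultimately have big: "ennreal (\<epsilon> * ?l) < emeasure lborel (?J \<inter> ?O)"
    using pos by (simp only:) (intro ennreal_lessI; linarith)
  define V where "V s = {x\<in>?J. dead_cell a b s (cell x s)}" for s
  define I where "I s = {cell (z - \<gamma>) s..<Suc (cell (z + \<delta>) s)}" for s
  have V_eq: "V s = ?J \<inter> (\<Union>d\<in>{d\<in>I s. dead_cell a b s d}. {real d / 2 ^ s..<(real d + 1) / 2 ^ s})" for s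
  proof (intro set_eqI iffI)
    fix x assume x: "x \<in> V s"
    then have "x \<in> ?J" by (simp add: V_def)
    then have "0 \<le> x" using in_cell by (simp add: less_imp_le)
    have "cell x s \<in> I s" using \<open>x \<in> ?J\<close> by (auto simp: I_def less_Suc_eq_le intro: cell_mono)
    moreover have "real (cell x s) / 2 ^ s \<le> x" "x < (real (cell x s) + 1) / 2 ^ s"
      using cell_bounds[OF \<open>0 \<le> x\<close>, of s] by (simp_all add: field_simps)
    ultimately show "x \<in> ?J \<inter> (\<Union>d\<in>{d\<in>I s. dead_cell a b s d}. {real d / 2 ^ s..<(real d + 1) / 2 ^ s})"
      using x by (auto simp: V_def)
  next
    fix x assume "x \<in> ?J \<inter> (\<Union>d\<in>{d\<in>I s. dead_cell a b s d}. {real d / 2 ^ s..<(real d + 1) / 2 ^ s})"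
    then obtain d where "x \<in> ?J" "dead_cell a b s d" "real d / 2 ^ s \<le> x" "x < (real d + 1) / 2 ^ s" by auto
    moreover from this have "cell x s = d" by (intro cell_eqI) (simp_all add: field_simps)
    ultimately show "x \<in> V s" by (simp add: V_def)
  qed
  have V_sets: "V s \<in> sets lborel" for s
    unfolding V_eq I_def by (intro sets.Int sets.finite_UN) auto
  have "incseq V"
  proof (rule incseq_SucI, rule subsetI)
    fix s x assume x: "x \<in> V s"
    then have "cell x (Suc s) div 2 = cell x s"
      using cell_div[of x s "Suc s"] in_cell(3)[of x] by (auto simp: V_def)
    with x show "x \<in> V (Suc s)" using dead_div2[of s "cell x (Suc s)"] by (auto simp: V_def)
  qed
  have cover: "?J \<inter> ?O \<subseteq> (\<Union>s. V s)"
  proof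
    fix x assume "x \<in> ?J \<inter> ?O"
    then obtain k where x: "x \<in> ?J" "rat_code (a k) < x" "x < rat_code (b k)"
      by (auto simp: rat_interval_def)
    have x0: "0 \<le> x" using in_cell(3)[OF x(1)] by simp
    obtain n where n: "(1 / 2) ^ n < min (x - rat_code (a k)) (rat_code (b k) - x)"
      using real_arch_pow_inv[of "min (x - rat_code (a k)) (rat_code (b k) - x)" "1 / 2"] x by auto
    define s where "s = max n (Suc k)"
    have "(1 / 2 :: real) ^ s \<le> (1 / 2) ^ n" by (intro power_decreasing) (auto simp: s_def)
    then have s: "1 / 2 ^ s < x - rat_code (a k)" "1 / 2 ^ s < rat_code (b k) - x" "k < s"
      using n by (auto simp: power_one_over s_def)
    have "real (cell x s) / 2 ^ s \<le> x" "x < (real (cell x s) + 1) / 2 ^ s"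
      using cell_bounds[OF x0, of s] by (simp_all add: field_simps)
    moreover have "(real (cell x s) + 1) / 2 ^ s = real (cell x s) / 2 ^ s + 1 / 2 ^ s"
      "real (Suc (cell x s)) / 2 ^ s = real (cell x s) / 2 ^ s + 1 / 2 ^ s"
      by (simp_all add: add_divide_distrib)
    ultimately have "rat_code (a k) < real (cell x s) / 2 ^ s" "real (Suc (cell x s)) / 2 ^ s < rat_code (b k)"
      using s(1,2) by linarith+
    then have "dead_cell a b s (cell x s)" unfolding dead_cell_def using s(3) by blast
    then show "x \<in> (\<Union>s. V s)" using x(1) by (auto simp: V_def)
  qed
  have "ennreal (\<epsilon> * ?l) < emeasure lborel (\<Union>s. V s)"
    using big cover by (rule less_le_trans[OF _ emeasure_mono]) (use V_sets in auto)
  also have "emeasure lborel (\<Union>s. V s) = (SUP s. emeasure lborel (V s))"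
    using V_sets \<open>incseq V\<close> by (intro SUP_emeasure_incseq[symmetric]) auto
  finally obtain s0 where s0: "ennreal (\<epsilon> * ?l) < emeasure lborel (V s0)" by (auto simp: less_SUP_iff)
  \<comment> \<open>The level must be so fine that the interval spans at least two cells, which pays
    for the at most two cells added by rounding outwards.\<close>
  obtain n where n: "(1 / 2) ^ n < ?l / 2" using real_arch_pow_inv[of "?l / 2" "1 / 2"] gd by auto
  define s where "s = max (max n (Suc t)) s0"
  have "(1 / 2 :: real) ^ s \<le> (1 / 2) ^ n" by (intro power_decreasing) (auto simp: s_def)
  with n have "1 / 2 ^ s < ?l / 2" by (simp add: power_one_over)
  then have l: "2 \<le> ?l * 2 ^ s" by (simp add: field_simps)
  have "t < s" by (simp add: s_def)
  let ?i = "cell (z - \<gamma>) s" and ?j = "Suc (cell (z + \<delta>) s)"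
  let ?D = "{x. x < ?j \<and> (?i \<le> x \<and> dead_cell a b s x)}"
  have ends: "z - \<gamma> \<in> ?J" "z + \<delta> \<in> ?J" "0 \<le> z - \<gamma>" "0 \<le> z + \<delta>"
    using gd in_cell(3)[of "z - \<gamma>"] in_cell(3)[of "z + \<delta>"] by auto
  have "ennreal (\<epsilon> * ?l) < emeasure lborel (V s)"
    by (rule less_le_trans[OF s0 emeasure_mono]) (use \<open>incseq V\<close> V_sets in \<open>auto simp: incseq_def s_def\<close>)
  also have "\<dots> \<le> emeasure lborel (\<Union>d\<in>{d\<in>I s. dead_cell a b s d}. {real d / 2 ^ s..<(real d + 1) / 2 ^ s})"
    unfolding V_eq by (intro emeasure_mono) (auto simp: I_def)
  also have "\<dots> \<le> (\<Sum>d\<in>{d\<in>I s. dead_cell a b s d}. emeasure lborel {real d / 2 ^ s..<(real d + 1) / 2 ^ s})"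
    by (intro emeasure_subadditive_finite) (auto simp: I_def)
  also have "\<dots> = (\<Sum>d\<in>{d\<in>I s. dead_cell a b s d}. ennreal (1 / 2 ^ s))"
    by (intro sum.cong refl) (simp add: divide_right_mono diff_divide_distrib[symmetric])
  also have "\<dots> = ennreal (card {d\<in>I s. dead_cell a b s d} * (1 / 2 ^ s))"
    by (simp add: ennreal_of_nat_eq_real_of_nat ennreal_mult'[symmetric])
  also have "{d\<in>I s. dead_cell a b s d} = ?D" by (auto simp: I_def)
  finally have "\<epsilon> * ?l < card ?D * (1 / 2 ^ s)" using \<epsilon>(1) gd by (simp add: ennreal_less_iff)
  then have D: "\<epsilon> * (?l * 2 ^ s) < card ?D" by (simp add: field_simps)
  have "real ?j \<le> ?i + 2 * (?l * 2 ^ s)"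
    using cell_bounds(1)[OF ends(4), of s] cell_bounds(2)[OF ends(3), of s] l by (simp add: algebra_simps)
  also have "2 * (?l * 2 ^ s) = 2 / \<epsilon> * (\<epsilon> * (?l * 2 ^ s))" using \<epsilon>(1) by simp
  also have "\<dots> \<le> real K * card ?D" using D K \<epsilon>(1) gd by (intro mult_mono) auto
  finally have "real ?j \<le> real (?i + K * card ?D)" by simp
  then have 1: "?j \<le> ?i + K * card ?D" by (simp only: of_nat_le_iff)
  have div: "cell x s div 2 ^ (s - t) = c" if "x \<in> ?J" for x
    using cell_div[of x t s] cell_J[OF that] in_cell(3)[OF that] \<open>t < s\<close> by simp
  have "z \<in> ?J" using gd by simp
  have 2: "?i \<le> cell z s" "cell z s < ?j" using gd by (auto simp: less_Suc_eq_le intro: cell_mono)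
  have 3: "c * 2 ^ (s - t) \<le> ?i" using div[OF ends(1)] by (metis div_times_less_eq_dividend)
  have 4: "?j \<le> Suc c * 2 ^ (s - t)"
    using div[OF ends(2)] dividend_less_div_times[of "2 ^ (s - t)" "cell (z + \<delta>) s"] by simp
  have "drop_at t s (cell z s)"
    unfolding drop_at_def div[OF \<open>z \<in> ?J\<close>] less_Suc_eq_le
    by (rule exI[of _ ?i], rule conjI[OF 2(1)], rule exI[of _ ?j]) (intro conjI 1 2 3 4)
  then show ?thesis using \<open>t < s\<close> by blast
qed

theorem theorem3p6:
  fixes z :: real
  assumes "z \<in> {0..1}"
    and "martin_loef_random z"
    and "\<not> density_one_point z"
  shows "uniformly_ae_dominating z"
proof -
  obtain C where C: "effectively_closed C" "z \<in> C" "lower_density C z \<noteq> 1"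
    using assms(3) unfolding density_one_point_def by blast
  then obtain a b where ab: "computable a" "computable b"
    and compl: "{0..1} - C = {0..1} \<inter> (\<Union>k. rat_interval (a k) (b k))" and sub: "C \<subseteq> {0..1}"
    unfolding effectively_closed_def by blast
  obtain \<epsilon> where \<epsilon>: "0 < \<epsilon>" "\<And>\<eta>. 0 < \<eta> \<Longrightarrow> \<exists>\<gamma> \<delta>. 0 < \<gamma> \<and> \<gamma> < \<eta> \<and> 0 < \<delta> \<and> \<delta> < \<eta> \<and>
      measure lborel ({z - \<gamma>..z + \<delta>} \<inter> C) < (1 - \<epsilon>) * (\<gamma> + \<delta>)"
    using lower_density_neq_1[OF C(3)] by blast
  obtain K :: nat where K: "2 / \<epsilon> \<le> real K" using real_arch_simple by blast
  have not_dyadic: "\<And>x n. z \<noteq> real x / 2 ^ n" by (rule martin_loef_random_not_dyadic[OF assms(2,1)])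
  have z: "0 \<le> z" "z < 1" using assms(1) not_dyadic[of 1 0] by auto
  interpret dead_cells "dead_cell a b" K by (rule dead_cells_dead_cell)
  show ?thesis
  proof (rule uniformly_ae_dominating_if_drops[OF assms(2,1) recfun_dead_cell[OF ab]])
    show "\<exists>s>t. drop_at t s (cell z s)" for t
      by (rule drop_if_not_density_one[OF compl sub z not_dyadic \<epsilon> K])
    show "\<not> dead_cell a b s (cell z s)" for s
    proof
      assume "dead_cell a b s (cell z s)"
      then obtain k where "rat_code (a k) < real (cell z s) / 2 ^ s" "real (Suc (cell z s)) / 2 ^ s < rat_code (b k)"
        by (auto simp: dead_cell_def)
      moreover have "real (cell z s) / 2 ^ s \<le> z" "z < real (Suc (cell z s)) / 2 ^ s"
        using cell_bounds[OF z(1), of s] by (simp_all add: field_simps)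
      ultimately have "z \<in> rat_interval (a k) (b k)" unfolding rat_interval_def by auto
      then show False using compl C(2) assms(1) by blast
    qed
  qed
qed

end
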